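(* Let $\boldsymbol{X}=(X_1,\dots,X_d)$, $d\ge 2$, be an HT-HSCM on a DAG $\mathcal{D}=(V,E)$ with $V=\{1,\dots,d\}$, and let $\Gamma^*_{12}$ and $\Gamma^*_{21}$ be the standardized causal tail coefficients between $X_1$ and $X_2$. Then the values of $\Gamma^*_{12}$ and $\Gamma^*_{21}$ distinguish the following four cases: (a) $X_1$ causes $X_2$, i.e. $1\in an(2)$; (b) $X_2$ causes $X_1$, i.e. $2\in an(1)$; (c) there is no causal link between $X_1$ and $X_2$, i.e. $An(1)\cap An(2)=\emptyset$; (d) there is a node $j\notin\{1,2\}$ with $j\in an(1)\cap an(2)$, and neither $1\in an(2)$ nor $2\in an(1)$. Precisely: (a) holds if and only if $\Gamma^*_{12}=1$ and $\Gamma^*_{21}\in(0,1)$; (b) holds if and only if $\Gamma^*_{12}\in(0,1)$ and $\Gamma^*_{21}=1$; (c) holds if and only if $\Gamma^*_{12}=\Gamma^*_{21}=0$; (d) holds if and only if $\Gamma^*_{12}\in(0,1)$ and $\Gamma^*_{21}\in(0,1)$; and no other combination of values of $(\Gamma^*_{12},\Gamma^*_{21})$ can occur.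
   Context: **Graphs.** $\mathcal{D}=(V,E)$ is a directed acyclic graph (DAG) with $V=\{1,\dots,d\}$; $pa(i)=\{j\in V:(j,i)\in E\}$. $an(i)$ is the set of nodes $j$ for which there is a directed path (with at least one edge) from $j$ to $i$, and $An(i)=an(i)\cup\{i\}$. **HT-HSCM.** A Heavy-Tailed Homogeneous Structural Causal Model on $\mathcal{D}$ is a random vector $\boldsymbol{X}=(X_1,\dots,X_d)$ satisfying $X_i=f_{pa(i)}(\boldsymbol{X}_{pa(i)},\varepsilon_i)$, $i=1,\dots,d$, where $\boldsymbol{X}_{pa(i)}=(X_j)_{j\in pa(i)}$ and: - $\varepsilon_1,\dots,\varepsilon_d$ are i.i.d. non-negative random variables, regularly varying with tail index $\alpha>0$: $\mathbb{P}(\varepsilon_i>x)\sim \ell(x)x^{-\alpha}$ as $x\to\infty$, for a slowly varying function $\ell$; - each $f_{pa(i)}:\mathbb{R}_+^{|pa(i)|+1}\to\mathbb{R}_+$ (with $\mathbb{R}_+=[0,\infty)$) is non-negative; satisfies $f_{pa(i)}(x)=0\iff x=0$; is continuous; is homogeneous of degree 1, i.e. $f_{pa(i)}(cx)=cf_{pa(i)}(x)$ for all $c>0$ and all $x$; and satisfies coordinate deletion monotonicity: $f_{pa(i)}(x)\ge f_{pa(i)}\big(\sum_{j\in J}x_j\mathbf{e}_j\big)$ for every $x$ in the domain and every nonempty $J\subseteq\{1,\dots,|pa(i)|+1\}$, where $\mathbf{e}_j$ are the standard basis vectors; - the marginal distribution of each $X_i$ is continuous. **Standardized causal tail coefficient.**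 Let $G_i$ be the cumulative distribution function of $X_i$. For $i,j\in V$, $\Gamma^*_{ji}=\lim_{x\to\infty}\mathbb{E}[2G_i(X_i)-1\mid X_j>x]$ (these limits exist). *)

theory Defs
  imports "HOL-Probability.Probability" "HOL-Library.Landau_Symbols"
begin

definition parents :: "(nat \<times> nat) set \<Rightarrow> nat \<Rightarrow> nat set"
  where "parents E i = {j. (j, i) \<in> E}"

definition ancestors :: "(nat \<times> nat) set \<Rightarrow> nat \<Rightarrow> nat set"
  where "ancestors E i = {j. (j, i) \<in> E\<^sup>+}"

definition Ancestors :: "(nat \<times> nat) set \<Rightarrow> nat \<Rightarrow> nat set"
  where "Ancestors E i = ancestors E i \<union> {i}"

definition slowly_varying :: "(real \<Rightarrow> real) \<Rightarrow> bool"
  where "slowly_varying l \<longleftrightarrow>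
    l \<in> borel_measurable borel \<and>
    eventually (\<lambda>x. 0 < l x) at_top \<and>
    (\<forall>t>0. ((\<lambda>x. l (t * x) / l x) \<longlongrightarrow> 1) at_top)"

definition regularly_varying_tail :: "'a measure \<Rightarrow> ('a \<Rightarrow> real) \<Rightarrow> real \<Rightarrow> bool"
  where "regularly_varying_tail M Y \<alpha> \<longleftrightarrow>
    (\<exists>l. slowly_varying l \<and>
      (\<lambda>x. measure M {\<omega> \<in> space M. Y \<omega> > x}) \<sim>[at_top] (\<lambda>x. l x * x powr (- \<alpha>)))"

text \<open>
  A vector in the non-negative orthant with coordinates indexed by \<open>I\<close> is an extensional
  function on \<open>I\<close>. For finite \<open>I\<close> the topology that the product topology on functions induces
  on this set is the Euclidean one, which is what \<^const>\<open>continuous_on\<close> refers to below.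
\<close>

definition orthant :: "'i set \<Rightarrow> ('i \<Rightarrow> real) set"
  where "orthant I = (I \<rightarrow>\<^sub>E {0..})"

definition homogeneous_structural_function :: "'i set \<Rightarrow> (('i \<Rightarrow> real) \<Rightarrow> real) \<Rightarrow> bool"
  where "homogeneous_structural_function I f \<longleftrightarrow>
    (\<forall>x\<in>orthant I. 0 \<le> f x) \<and>
    (\<forall>x\<in>orthant I. f x = 0 \<longleftrightarrow> x = (\<lambda>k\<in>I. 0)) \<and>
    continuous_on (orthant I) f \<and>
    (\<forall>c>0. \<forall>x\<in>orthant I. f (\<lambda>k\<in>I. c * x k) = c * f x) \<and>
    (\<forall>x\<in>orthant I. \<forall>J. J \<subseteq> I \<and> J \<noteq> {} \<longrightarrow> f (\<lambda>k\<in>I. if k \<in> J then x k else 0) \<le> f x)"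

text \<open>
  The structural function of node \<open>i\<close> has one coordinate \<^term>\<open>Some j\<close> for every parent \<open>j\<close>
  of \<open>i\<close>, and the coordinate \<^term>\<open>None\<close> for the noise variable of \<open>i\<close>.
\<close>

definition inputs :: "(nat \<times> nat) set \<Rightarrow> nat \<Rightarrow> nat option set"
  where "inputs E i = insert None (Some ` parents E i)"

definition input_vector ::
    "(nat \<times> nat) set \<Rightarrow> nat \<Rightarrow> (nat \<Rightarrow> real) \<Rightarrow> real \<Rightarrow> nat option \<Rightarrow> real"
  where "input_vector E i x e =
    (\<lambda>k\<in>inputs E i. case k of None \<Rightarrow> e | Some j \<Rightarrow> x j)"

locale ht_hscm = prob_space M
  for M :: "'a measure" +
  fixes d :: nat
    and E :: "(nat \<times> nat) set"
    and f :: "nat \<Rightarrow> (nat option \<Rightarrow> real) \<Rightarrow> real"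
    and \<epsilon> :: "nat \<Rightarrow> 'a \<Rightarrow> real"
    and \<alpha> :: real
    and X :: "nat \<Rightarrow> 'a \<Rightarrow> real"
  assumes edges: "E \<subseteq> {1..d} \<times> {1..d}"
    and acyclic_edges: "acyclic E"
    and noise_indep: "indep_vars (\<lambda>_. borel) \<epsilon> {1..d}"
    and noise_ident: "\<And>i j. i \<in> {1..d} \<Longrightarrow> j \<in> {1..d} \<Longrightarrow>
      distr M borel (\<epsilon> i) = distr M borel (\<epsilon> j)"
    and noise_nonneg: "\<And>i. i \<in> {1..d} \<Longrightarrow> AE \<omega> in M. 0 \<le> \<epsilon> i \<omega>"
    and tail_index_pos: "0 < \<alpha>"
    and noise_tail: "\<And>i. i \<in> {1..d} \<Longrightarrow> regularly_varying_tail M (\<epsilon> i) \<alpha>"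
    and structural_function: "\<And>i. i \<in> {1..d} \<Longrightarrow>
      homogeneous_structural_function (inputs E i) (f i)"
    and X_measurable: "\<And>i. i \<in> {1..d} \<Longrightarrow> random_variable borel (X i)"
    and structural_equation: "\<And>i. i \<in> {1..d} \<Longrightarrow>
      AE \<omega> in M. X i \<omega> = f i (input_vector E i (\<lambda>j. X j \<omega>) (\<epsilon> i \<omega>))"
    and continuous_marginal: "\<And>i. i \<in> {1..d} \<Longrightarrow>
      continuous_on UNIV (cdf (distr M borel (X i)))"

definition cond_expectation_event :: "'a measure \<Rightarrow> ('a \<Rightarrow> real) \<Rightarrow> 'a set \<Rightarrow> real"
  where "cond_expectation_event M Y A = (LINT \<omega>:A|M. Y \<omega>) / measure M A"

text \<open>
  \<^const>\<open>Lim\<close> is unspecified when there is no limit, so a value of the coefficient can only be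
  derived together with the existence of the limit.
\<close>

definition causal_tail_coeff :: "'a measure \<Rightarrow> (nat \<Rightarrow> 'a \<Rightarrow> real) \<Rightarrow> nat \<Rightarrow> nat \<Rightarrow> real"
  where "causal_tail_coeff M X j i =
    Lim at_top (\<lambda>x. cond_expectation_event M
      (\<lambda>\<omega>. 2 * cdf (distr M borel (X i)) (X i \<omega>) - 1) {\<omega> \<in> space M. X j \<omega> > x})"

end

(*  Composing the structural functions along the DAG gives X_i = F_i(eps) almost surely, where F_i
    is continuous, homogeneous of degree 1, depends on the noises of An(i) only, and, by coordinate
    deletion monotonicity, dominates a positive multiple of each of them. By the single big jump
    principle, up to o(P(eps > x)) the event X_j > x is the disjoint union over k in An(j) of the
    events a_k eps_k > x with a_k = F_j(e_k) > 0, which have probability ~ a_k^alpha P(eps > x).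
    On such an event X_i is forced to infinity if k is in An(i), so 2 G_i(X_i) - 1 tends to 1;
    otherwise X_i is independent of eps_k and 2 G_i(X_i) - 1 has mean 0. Therefore
      Gamma*_ji = (sum of a_k^alpha over An(i) Int An(j)) / (sum of a_k^alpha over An(j)),
    which is 0 iff An(i) and An(j) are disjoint and 1 iff j is in An(i). *)
theory Submission
  imports Defs
begin

section \<open>Representation in terms of the noise variables\<close>

text \<open>The noises are non-negative only almost surely, and the structural functions are
  controlled only on an orthant. Composing with \<open>max 0\<close> of each noise gives functions
  that are continuous on all real sequences, so measurability and neighbourhoods need no relative
  topology. F_i need not be monotone, so one large noise determines F_i only up to an error \<eta>
  times that noise. Indicators are therefore compared between the scale factors a_k - \<eta> and a_k
  + \<eta>; x tends to infinity for fixed \<eta>, and \<eta> is chosen small beforehand according to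
  the desired accuracy. The rank of X_i may depend on the same noises as the event X_j > x. The
  comparison is therefore integrated against an arbitrary bounded weight \<open>Z\<close>: the rank
  gives the numerator of the conditional expectation, the constant 1 its denominator.\<close>

text \<open>Functions of whole sequences with a dependence clause, rather than functions on a
  product over \<open>K\<close>, let all nodes share one noise sequence. The last clause is the
  trace of coordinate deletion monotonicity: it makes the values on the axes in \<open>K\<close>
  positive and drives \<open>F\<close> to infinity with any single noise in
  \<open>K\<close>.\<close>

definition aggregating :: "nat set \<Rightarrow> ((nat \<Rightarrow> real) \<Rightarrow> real) \<Rightarrow> bool"
  where "aggregating K F \<longleftrightarrow>
    continuous_on UNIV F \<and>
    (\<forall>e. 0 \<le> F e) \<and>
    (\<forall>c>0. \<forall>e. F (\<lambda>k. c * e k) = c * F e) \<and>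
    (\<forall>e e'. (\<forall>k\<in>K. e k = e' k) \<longrightarrow> F e = F e') \<and>
    (\<forall>k\<in>K. \<exists>c>0. \<forall>e. c * max 0 (e k) \<le> F e)"

lemma finite_parents: "finite E \<Longrightarrow> finite (parents E i)"
  unfolding parents_def by (rule finite_subset[of _ "fst ` E"]) force+

lemma Ancestors_parents:
  "Ancestors E i = insert i (\<Union>p\<in>parents E i. Ancestors E p)"
  unfolding Ancestors_def ancestors_def parents_def
  by (auto dest: tranclD2 rtranclD intro: trancl_into_trancl)

text \<open>Deleting all coordinates but k leaves \<open>x k\<close> times a unit vector, so
  homogeneity reduces the claim to the value of \<open>g\<close> there. That value is the constant
  c; it is positive because \<open>g\<close> vanishes only at 0.\<close>

lemma homogeneous_structural_function_lower_bound:
  assumes g: "homogeneous_structural_function I g" and k: "k \<in> I"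
  obtains c where "0 < c" "\<And>x. x \<in> orthant I \<Longrightarrow> c * x k \<le> g x"
proof
  let ?u = "\<lambda>l\<in>I. if l = k then 1 else 0 :: real"
  have u: "?u \<in> orthant I" by (auto simp: orthant_def)
  have "?u k \<noteq> (\<lambda>l\<in>I. 0 :: real) k" using k by simp
  then have "?u \<noteq> (\<lambda>l\<in>I. 0)" by metis
  then show "0 < g ?u"
    using g u unfolding homogeneous_structural_function_def by (metis less_eq_real_def)
  fix x assume x: "x \<in> orthant I"
  show "g ?u * x k \<le> g x"
  \<comment> \<open>Homogeneity concerns positive scalars only, so the factor 0 is treated
    apart.\<close>
  proof (cases "x k = 0")
    case True
    then show ?thesis using g x by (simp add: homogeneous_structural_function_def)
  next
    case False
    then have pos: "x k > 0" using x k by (auto simp: orthant_def PiE_iff less_eq_real_def)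
    have "g (\<lambda>l\<in>I. if l \<in> {k} then x l else 0) \<le> g x"
      using g x k unfolding homogeneous_structural_function_def by blast
    moreover have "(\<lambda>l\<in>I. if l \<in> {k} then x l else 0) = (\<lambda>l\<in>I. x k * ?u l)"
      by (auto simp: fun_eq_iff restrict_def)
    moreover have "g (\<lambda>l\<in>I. x k * ?u l) = x k * g ?u"
      using g u pos unfolding homogeneous_structural_function_def by blast
    ultimately show ?thesis by (simp add: mult.commute)
  qed
qed

text \<open>The clipped noise and the non-negative values \<open>F p e\<close> keep the input vector
  in the orthant for every real sequence \<open>e\<close>. Lower bounds multiply along an edge: a
  noise reaching i through a parent p gets the product of the constant of \<open>g\<close> in
  coordinate p and the constant of \<open>F p\<close>.\<close>

lemma aggregating_structural:
  assumes g: "homogeneous_structural_function (inputs E i) g"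
    and F: "\<And>p. p \<in> parents E i \<Longrightarrow> aggregating (Ancestors E p) (F p)"
  shows "aggregating (Ancestors E i)
    (\<lambda>e. g (input_vector E i (\<lambda>p. F p e) (max 0 (e i))))"
proof -
  define v where "v e = input_vector E i (\<lambda>p. F p e) (max 0 (e i))" for e
  have v_in: "v e \<in> orthant (inputs E i)" for e
    using F unfolding v_def orthant_def input_vector_def inputs_def aggregating_def
    by (auto split: option.splits)
  have v_None: "v e None = max 0 (e i)" for e
    by (simp add: v_def input_vector_def inputs_def)
  have v_Some: "v e (Some p) = F p e" if "p \<in> parents E i" for p e
    using that by (simp add: v_def input_vector_def inputs_def)
  have "continuous_on UNIV (\<lambda>e. v e k)" for k
  proof (cases k)
    case None
    then show ?thesis
      using continuous_on_product_then_coordinatewise[OF continuous_on_id, of UNIV i]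
      by (simp add: v_None continuous_on_max)
  next
    case (Some p)
    show ?thesis
    proof (cases "p \<in> parents E i")
      case True
      then show ?thesis using F[OF True] Some by (simp add: v_Some aggregating_def)
    next
      case False
      \<comment> \<open>Outside its index set an extensional vector has the constant value
        \<open>undefined\<close>, so this coordinate is continuous as well.\<close>
      then have "k \<notin> inputs E i" using Some by (auto simp: inputs_def)
      then show ?thesis by (simp add: v_def input_vector_def)
    qed
  qed
  then have "continuous_on UNIV v" by (rule continuous_on_coordinatewise_then_product)
  then have cont: "continuous_on UNIV (\<lambda>e. g (v e))"
    using g v_in unfolding homogeneous_structural_function_def
    by (intro continuous_on_compose2[of "orthant (inputs E i)" g UNIV v]) auto
  have nonneg: "0 \<le> g (v e)" for e
    using g v_in unfolding homogeneous_structural_function_def by blast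
  have v_scale: "v (\<lambda>k. c * e k) = (\<lambda>k\<in>inputs E i. c * v e k)" if "0 < c" for c e
  proof
    fix k
    have "max 0 (c * e i) = c * max 0 (e i)"
      using that by (simp add: max_mult_distrib_left)
    then show "v (\<lambda>k. c * e k) k = (\<lambda>k\<in>inputs E i. c * v e k) k"
      using F that
      by (auto simp: v_def input_vector_def inputs_def aggregating_def split: option.splits)
  qed
  have hom: "g (v (\<lambda>k. c * e k)) = c * g (v e)" if "0 < c" for c e
    using g v_in that unfolding v_scale[OF that] homogeneous_structural_function_def by blast
  have dep: "g (v e) = g (v e')" if eq: "\<forall>k\<in>Ancestors E i. e k = e' k" for e e'
  proof -
    have "F p e = F p e'" if "p \<in> parents E i" for p
      using F[OF that] eq that unfolding aggregating_def Ancestors_parents[of E i] by blast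
    moreover have "e i = e' i" using eq by (simp add: Ancestors_parents[of E i])
    ultimately have "v e = v e'"
      by (auto simp: v_def input_vector_def inputs_def fun_eq_iff split: option.splits)
    then show ?thesis by simp
  qed
  have low: "\<exists>c>0. \<forall>e. c * max 0 (e k) \<le> g (v e)" if k: "k \<in> Ancestors E i" for k
  proof (cases "k = i")
    case True
    obtain c where "0 < c" "\<And>x. x \<in> orthant (inputs E i) \<Longrightarrow> c * x None \<le> g x"
      using homogeneous_structural_function_lower_bound[OF g, of None]
      by (auto simp: inputs_def)
    then show ?thesis using v_in v_None True by metis
  next
    case False
    then obtain p where p: "p \<in> parents E i" "k \<in> Ancestors E p"
      using k unfolding Ancestors_parents[of E i] by blast
    obtain c where c: "0 < c" "\<And>x. x \<in> orthant (inputs E i) \<Longrightarrow> c * x (Some p) \<le> g x"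
      using homogeneous_structural_function_lower_bound[OF g, of "Some p"] p
      by (auto simp: inputs_def)
    obtain b where b: "0 < b" "\<And>e. b * max 0 (e k) \<le> F p e"
      using F[OF p(1)] p(2) unfolding aggregating_def by blast
    have "c * b * max 0 (e k) \<le> g (v e)" for e
    proof -
      have "c * (b * max 0 (e k)) \<le> c * F p e" using b c by (intro mult_left_mono) auto
      also have "\<dots> \<le> g (v e)" using c(2)[OF v_in, of e] v_Some[OF p(1)] by simp
      finally show ?thesis by (simp add: mult.assoc)
    qed
    then show ?thesis using b c by (intro exI[of _ "c * b"]) auto
  qed
  show ?thesis
    unfolding aggregating_def v_def[symmetric] using cont nonneg hom dep low by blast
qed

text \<open>A finite acyclic edge relation is well-founded, which permits induction from parents to
  children.\<close>

lemma (in ht_hscm) noise_representation: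
  assumes "i \<in> {1..d}"
  obtains F where "aggregating (Ancestors E i) F" "AE \<omega> in M. X i \<omega> = F (\<lambda>k. \<epsilon> k \<omega>)"
proof -
  have fin: "finite E" using edges by (rule finite_subset) simp
  then have "wf E" using acyclic_edges by (rule finite_acyclic_wf)
  then have "i \<in> {1..d} \<longrightarrow> (\<exists>F. aggregating (Ancestors E i) F \<and>
    (AE \<omega> in M. X i \<omega> = F (\<lambda>k. \<epsilon> k \<omega>)))"
  proof (induction i rule: wf_induct_rule)
    case (less i)
    show ?case
    proof
      assume i: "i \<in> {1..d}"
      have "\<forall>p. p \<in> parents E i \<longrightarrow> (\<exists>F. aggregating (Ancestors E p) F \<and>
          (AE \<omega> in M. X p \<omega> = F (\<lambda>k. \<epsilon> k \<omega>)))"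
        using less edges unfolding parents_def by blast
      then obtain F where F: "\<And>p. p \<in> parents E i \<Longrightarrow> aggregating (Ancestors E p) (F p)"
        and X: "\<And>p. p \<in> parents E i \<Longrightarrow> AE \<omega> in M. X p \<omega> = F p (\<lambda>k. \<epsilon> k \<omega>)"
        by metis
      have "AE \<omega> in M. \<forall>p\<in>parents E i. X p \<omega> = F p (\<lambda>k. \<epsilon> k \<omega>)"
        using X finite_parents[OF fin] by (intro AE_finite_allI) auto
      \<comment> \<open>Off a null set the noise is non-negative, so clipping does not change
        it.\<close>
      then have "AE \<omega> in M. X i \<omega> =
          f i (input_vector E i (\<lambda>p. F p (\<lambda>k. \<epsilon> k \<omega>)) (max 0 (\<epsilon> i \<omega>)))"
        using structural_equation[OF i] noise_nonneg[OF i]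
      proof eventually_elim
        case (elim \<omega>)
        then have "input_vector E i (\<lambda>j. X j \<omega>) (\<epsilon> i \<omega>) =
            input_vector E i (\<lambda>p. F p (\<lambda>k. \<epsilon> k \<omega>)) (max 0 (\<epsilon> i \<omega>))"
          by (auto simp: input_vector_def inputs_def fun_eq_iff split: option.splits)
        then show ?case using elim by simp
      qed
      then show "\<exists>F. aggregating (Ancestors E i) F \<and> (AE \<omega> in M. X i \<omega> = F (\<lambda>k. \<epsilon> k \<omega>))"
        using aggregating_structural[OF structural_function[OF i] F] by blast
    qed
  qed
  then show ?thesis using assms that by blast
qed

section \<open>The single big jump principle\<close>

text \<open>A basic open box of the product topology may also constrain coordinates outside
  \<open>K\<close>. Dependence on \<open>K\<close> alone removes these constraints, and finiteness
  of \<open>K\<close> gives a common radius.\<close>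

lemma continuous_finite_dependence:
  fixes F :: "(nat \<Rightarrow> real) \<Rightarrow> real"
  assumes cont: "continuous_on UNIV F" and K: "finite K"
    and dep: "\<And>e e'. (\<forall>k\<in>K. e k = e' k) \<Longrightarrow> F e = F e'" and "0 < \<eta>"
  obtains r where "0 < r" "\<And>e. (\<forall>k\<in>K. \<bar>e k - u k\<bar> \<le> r) \<Longrightarrow> \<bar>F e - F u\<bar> \<le> \<eta>"
proof -
  define U where "U = F -` ball (F u) \<eta>"
  have "open U"
    using cont unfolding U_def by (simp add: continuous_on_open_vimage)
  then have "openin (product_topology (\<lambda>i. euclidean) UNIV) U"
    by (simp add: euclidean_product_topology)
  moreover have "u \<in> U" using \<open>0 < \<eta>\<close> by (simp add: U_def)
  ultimately obtain Y where Y: "u \<in> (\<Pi>\<^sub>E i\<in>UNIV. Y i)" "\<And>i. open (Y i)" "(\<Pi>\<^sub>E i\<in>UNIV. Y i) \<subseteq> U"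
    using product_topology_open_contains_basis[of "\<lambda>i. euclidean" UNIV U u] by auto
  have "\<exists>s>0. cball (u k) s \<subseteq> Y k" for k
    using Y(1) Y(2)[of k] by (auto simp: open_contains_cball)
  then obtain s where s: "\<And>k. 0 < s k" "\<And>k. cball (u k) (s k) \<subseteq> Y k" by metis
  define r where "r = Min (insert 1 (s ` K))"
  have r: "0 < r" "\<And>k. k \<in> K \<Longrightarrow> r \<le> s k"
    using K s by (auto simp: r_def)
  have "\<bar>F e - F u\<bar> \<le> \<eta>" if e: "\<forall>k\<in>K. \<bar>e k - u k\<bar> \<le> r" for e
  proof -
    \<comment> \<open>Resetting the coordinates outside \<open>K\<close> to those of
      \<open>u\<close> puts the point in the box without changing \<open>F\<close>.\<close>
    let ?e = "\<lambda>k. if k \<in> K then e k else u k"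
    have "?e k \<in> Y k" for k
    proof (rule subsetD[OF s(2)])
      show "?e k \<in> cball (u k) (s k)"
        using e r(2)[of k] s(1)[of k] by (fastforce simp: dist_real_def abs_minus_commute)
    qed
    then have "?e \<in> U" using Y(3) by (auto simp: PiE_iff)
    moreover have "F ?e = F e" by (rule dep) simp
    ultimately show ?thesis by (simp add: U_def dist_real_def abs_minus_commute)
  qed
  then show ?thesis using that r(1) by blast
qed

definition unit_noise :: "nat \<Rightarrow> nat \<Rightarrow> real"
  where "unit_noise k = (\<lambda>l. if l = k then 1 else 0)"

lemma aggregating_zero:
  assumes "aggregating K F"
  shows "F (\<lambda>_. 0) = 0"
proof -
  have "F (\<lambda>k. 2 * (\<lambda>_. 0) k) = 2 * F (\<lambda>_. 0)"
    using assms unfolding aggregating_def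
    by (metis zero_less_numeral)
  then show ?thesis by simp
qed

text \<open>By continuity at 0, where \<open>F\<close> vanishes, \<open>F\<close> is at most 1 on a
  box of some radius r. Scaling by r / m moves \<open>e\<close> into that box, and homogeneity turns
  the bound into m / r.\<close>

lemma aggregating_linear_growth:
  assumes F: "aggregating K F" and K: "finite K"
  obtains C where "1 \<le> C"
    "\<And>e m. (\<forall>k\<in>K. 0 \<le> e k \<and> e k \<le> m) \<Longrightarrow> 0 < m \<Longrightarrow> F e \<le> C * m"
proof -
  have dep: "\<And>e e'. (\<forall>k\<in>K. e k = e' k) \<Longrightarrow> F e = F e'" and cont: "continuous_on UNIV F"
    using F unfolding aggregating_def by blast+
  obtain r where r: "0 < r" "\<And>e. (\<forall>k\<in>K. \<bar>e k - 0\<bar> \<le> r) \<Longrightarrow> \<bar>F e - F (\<lambda>_. 0)\<bar> \<le> 1"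
    using continuous_finite_dependence[OF cont K dep, of 1 "\<lambda>_. 0"] by auto
  show ?thesis
  proof
    show "1 \<le> max 1 (1 / r)" by simp
    fix e :: "nat \<Rightarrow> real" and m :: real
    assume e: "\<forall>k\<in>K. 0 \<le> e k \<and> e k \<le> m" and m: "0 < m"
    have "F (\<lambda>k. (r / m) * e k) \<le> 1"
    proof -
      have "\<bar>(r / m) * e k\<bar> \<le> r" if "k \<in> K" for k
      proof -
        have "r / m * e k \<le> r / m * m" using e that m r(1) by (intro mult_left_mono) auto
        then show ?thesis using e that m r(1) by (auto simp: abs_mult)
      qed
      then show ?thesis using r(2)[of "\<lambda>k. (r / m) * e k"] aggregating_zero[OF F] by simp
    qed
    moreover have "F (\<lambda>k. (r / m) * e k) = (r / m) * F e"
      using F m r(1) unfolding aggregating_def by (meson divide_pos_pos)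
    ultimately have "(r / m) * F e \<le> 1" by simp
    then have "F e \<le> (1 / r) * m" using m r(1) by (simp add: divide_simps mult.commute)
    also have "\<dots> \<le> max 1 (1 / r) * m" using m by (intro mult_right_mono) auto
    finally show "F e \<le> max 1 (1 / r) * m" .
  qed
qed

lemma aggregating_unit_pos:
  assumes "aggregating K F" "k \<in> K"
  shows "0 < F (unit_noise k)"
proof -
  obtain c where c: "0 < c" "\<And>e. c * max 0 (e k) \<le> F e"
    using assms unfolding aggregating_def by blast
  then show ?thesis using c(2)[of "unit_noise k"] by (simp add: unit_noise_def)
qed

text \<open>Division by \<open>e k\<close> moves \<open>e\<close> close to the k-th unit vector,
  where continuity applies; scaling back multiplies the error \<eta> by \<open>e k\<close>.\<close>

lemma aggregating_near_axis:
  assumes F: "aggregating K F" and K: "finite K" and "k \<in> K" and "0 < \<eta>"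
  obtains r where "0 < r" "\<And>e. 0 < e k \<Longrightarrow> (\<forall>l\<in>K - {k}. \<bar>e l\<bar> \<le> r * e k) \<Longrightarrow>
    \<bar>F e - F (unit_noise k) * e k\<bar> \<le> \<eta> * e k"
proof -
  have dep: "\<And>e e'. (\<forall>k\<in>K. e k = e' k) \<Longrightarrow> F e = F e'" and cont: "continuous_on UNIV F"
    using F unfolding aggregating_def by blast+
  obtain r where r: "0 < r" "\<And>e. (\<forall>l\<in>K. \<bar>e l - unit_noise k l\<bar> \<le> r) \<Longrightarrow>
      \<bar>F e - F (unit_noise k)\<bar> \<le> \<eta>"
    using continuous_finite_dependence[OF cont K dep \<open>0 < \<eta>\<close>] by metis
  have "\<bar>F e - F (unit_noise k) * e k\<bar> \<le> \<eta> * e k"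
    if e: "0 < e k" "\<forall>l\<in>K - {k}. \<bar>e l\<bar> \<le> r * e k" for e
  proof -
    have "\<bar>(1 / e k) * e l - unit_noise k l\<bar> \<le> r" if "l \<in> K" for l
      using e that r(1) by (cases "l = k") (auto simp: unit_noise_def abs_mult field_simps)
    then have "\<bar>F (\<lambda>l. (1 / e k) * e l) - F (unit_noise k)\<bar> \<le> \<eta>" using r(2) by simp
    moreover have "F (\<lambda>l. (1 / e k) * e l) = (1 / e k) * F e"
      using F e(1) unfolding aggregating_def by (meson zero_less_divide_1_iff)
    ultimately have "\<bar>(1 / e k) * F e - F (unit_noise k)\<bar> * e k \<le> \<eta> * e k"
      using e(1) by (intro mult_right_mono) auto
    moreover have "\<bar>(1 / e k) * F e - F (unit_noise k)\<bar> * e k =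
        \<bar>((1 / e k) * F e - F (unit_noise k)) * e k\<bar>"
      using e(1) by (simp add: abs_mult)
    moreover have "((1 / e k) * F e - F (unit_noise k)) * e k = F e - F (unit_noise k) * e k"
      using e(1) by (simp add: field_simps)
    ultimately show ?thesis by simp
  qed
  then show ?thesis using that r(1) by blast
qed

text \<open>
  If at most one noise exceeds \<open>\<delta> x\<close>, then either every indicator vanishes or the
  largest coordinate \<open>e k\<close> dominates all others, so that \<open>F e\<close> lies within
  \<open>\<eta> * e k\<close> of its value on the \<open>k\<close>-th axis. Both kinds of error are written as
  indicators, so that the bound can be integrated without measurability of \<open>F\<close>.
\<close>

lemma single_big_jump_pointwise:
  assumes F: "aggregating K F" and K: "finite K" "K \<noteq> {}" and \<eta>: "0 < \<eta>"
  obtains \<delta> where "0 < \<delta>"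
    "\<And>x e. 0 < x \<Longrightarrow> (\<forall>k\<in>K. 0 \<le> e k) \<Longrightarrow>
      \<bar>of_bool (F e > x) - (\<Sum>k\<in>K. of_bool (F (unit_noise k) * e k > x))\<bar> \<le>
      (\<Sum>k\<in>K. of_bool ((F (unit_noise k) + \<eta>) * e k > x) - of_bool ((F (unit_noise k) - \<eta>) * e k > x)) +
      (card K + 1) * (\<Sum>k\<in>K. \<Sum>l\<in>K - {k}. of_bool (e k > \<delta> * x \<and> e l > \<delta> * x) :: real)"
proof -
  define a where "a k = F (unit_noise k)" for k
  obtain C where C: "1 \<le> C"
    "\<And>e m. (\<forall>k\<in>K. 0 \<le> e k \<and> e k \<le> m) \<Longrightarrow> 0 < m \<Longrightarrow> F e \<le> C * m"
    using aggregating_linear_growth[OF F K(1)] by metis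
  have "\<exists>r>0. \<forall>e. 0 < e k \<longrightarrow> (\<forall>l\<in>K - {k}. \<bar>e l\<bar> \<le> r * e k) \<longrightarrow> \<bar>F e - a k * e k\<bar> \<le> \<eta> * e k"
    if "k \<in> K" for k
    using aggregating_near_axis[OF F K(1) that \<eta>] unfolding a_def by metis
  then obtain s where s: "\<And>k. k \<in> K \<Longrightarrow> 0 < s k"
    "\<And>k e. k \<in> K \<Longrightarrow> 0 < e k \<Longrightarrow> (\<forall>l\<in>K - {k}. \<bar>e l\<bar> \<le> s k * e k) \<Longrightarrow> \<bar>F e - a k * e k\<bar> \<le> \<eta> * e k"
    by metis
  define r where "r = Min (insert 1 (s ` K))"
  have r: "0 < r" "r \<le> 1" "\<And>k. k \<in> K \<Longrightarrow> r \<le> s k"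
    using K s(1) by (auto simp: r_def intro: min.coboundedI2 Min_le)
  \<comment> \<open>The choice serves two estimates for noises \<open>e l\<close> of size at most
    \<delta> x: \<open>a l * e l\<close> is at most r x, hence at most x, and when
    \<open>C * e k\<close> exceeds x, \<open>e l\<close> is at most r times \<open>e k\<close>, as
    closeness to the axis requires.\<close>
  define \<delta> where "\<delta> = r / C"
  have \<delta>: "0 < \<delta>" "C * \<delta> = r" using r C(1) by (auto simp: \<delta>_def)
  have a_le: "a k \<le> C" for k
    using C(2)[of "unit_noise k" 1] by (auto simp: a_def unit_noise_def)
  have a_nonneg: "0 \<le> a k" for k using F by (simp add: a_def aggregating_def)
  have "\<bar>of_bool (F e > x) - (\<Sum>k\<in>K. of_bool (a k * e k > x))\<bar> \<le>
      (\<Sum>k\<in>K. of_bool ((a k + \<eta>) * e k > x) - of_bool ((a k - \<eta>) * e k > x)) +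
      (card K + 1) * (\<Sum>k\<in>K. \<Sum>l\<in>K - {k}. of_bool (e k > \<delta> * x \<and> e l > \<delta> * x) :: real)"
    (is "?L \<le> ?S + _ * ?D")
    if x: "0 < x" and e: "\<forall>k\<in>K. 0 \<le> e k" for x e
  proof -
    have S_term: "0 \<le> (of_bool ((a l + \<eta>) * e l > x) - of_bool ((a l - \<eta>) * e l > x) :: real)"
      if "l \<in> K" for l
    proof -
      have "(a l - \<eta>) * e l \<le> (a l + \<eta>) * e l" using e that \<eta> by (intro mult_right_mono) auto
      then show ?thesis by auto
    qed
    then have S: "0 \<le> ?S" by (rule sum_nonneg)
    have D: "0 \<le> ?D" by (intro sum_nonneg) auto
    have "Max (e ` K) \<in> e ` K" using K by (intro Max_in) auto
    then obtain k where k: "k \<in> K" and "e k = Max (e ` K)" by auto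
    then have k_max: "\<And>l. l \<in> K \<Longrightarrow> e l \<le> e k" using K by simp
    show ?thesis
    proof (cases "\<exists>l\<in>K - {k}. e l > \<delta> * x")
      case True
      then obtain l where l: "l \<in> K - {k}" "e l > \<delta> * x" by blast
      then have "e k > \<delta> * x" using k_max[of l] by auto
      then have "1 = (of_bool (e k > \<delta> * x \<and> e l > \<delta> * x) :: real)" using l by simp
      also have "\<dots> \<le> (\<Sum>l\<in>K - {k}. of_bool (e k > \<delta> * x \<and> e l > \<delta> * x))"
        using l K by (intro member_le_sum) auto
      also have "\<dots> \<le> ?D"
        using k K by (intro member_le_sum[of k K
          "\<lambda>k. \<Sum>l\<in>K - {k}. of_bool (e k > \<delta> * x \<and> e l > \<delta> * x)"] sum_nonneg) auto
      finally have "1 \<le> ?D" .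
      \<comment> \<open>The left side compares a number in [0, 1] with one in [0, card K]; hence the
        factor \<open>card K + 1\<close>.\<close>
      then have "real (card K + 1) * 1 \<le> real (card K + 1) * ?D" by (intro mult_left_mono) auto
      moreover have "(\<Sum>k\<in>K. of_bool (a k * e k > x)) \<le> (\<Sum>k\<in>K. 1 :: real)"
        by (rule sum_mono) auto
      moreover have "0 \<le> (\<Sum>k\<in>K. of_bool (a k * e k > x) :: real)"
        by (intro sum_nonneg) auto
      ultimately have "?L \<le> real (card K + 1) * 1"
        by (cases "F e > x") auto
      also note \<open>real (card K + 1) * 1 \<le> real (card K + 1) * ?D\<close>
      finally show ?thesis using S by linarith
    next
      case False
      then have small: "\<And>l. l \<in> K \<Longrightarrow> l \<noteq> k \<Longrightarrow> e l \<le> \<delta> * x" by force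
      have others: "a l * e l \<le> x" if "l \<in> K" "l \<noteq> k" for l
      proof -
        have "a l * e l \<le> C * (\<delta> * x)"
          using small[OF that] a_le[of l] a_nonneg[of l] e that C(1)
          by (intro mult_mono) auto
        also have "\<dots> \<le> x" using r x \<delta>(2) by (simp add: mult.assoc[symmetric])
        finally show ?thesis .
      qed
      have "(\<Sum>l\<in>K. of_bool (a l * e l > x)) =
          (\<Sum>l\<in>K. if l = k then of_bool (a k * e k > x) else 0 :: real)"
        using others by (intro sum.cong) (auto simp: not_less)
      then have L: "?L = \<bar>of_bool (F e > x) - of_bool (a k * e k > x)\<bar>"
        using k K by (simp add: sum.delta)
      show ?thesis
      proof (cases "C * e k \<le> x")
        case True
        have "a k * e k \<le> C * e k" using a_le e k by (intro mult_right_mono) auto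
        moreover have "F e \<le> C * (x / C)"
        proof (rule C(2))
          show "\<forall>l\<in>K. 0 \<le> e l \<and> e l \<le> x / C"
          proof
            fix l assume l: "l \<in> K"
            have "e k \<le> x / C" using True C(1) by (simp add: pos_le_divide_eq mult.commute)
            then show "0 \<le> e l \<and> e l \<le> x / C" using e k_max[OF l] l by auto
          qed
          show "0 < x / C" using x C(1) by simp
        qed
        ultimately have "?L = 0" using True C(1) L by (simp add: not_less)
        then show ?thesis using S D by simp
      next
        case False
        then have "0 < C * e k" using x by linarith
        then have ek: "0 < e k" using C(1) by (simp add: zero_less_mult_iff)
        have "\<bar>e l\<bar> \<le> s k * e k" if "l \<in> K - {k}" for l
        proof -
          have "\<bar>e l\<bar> \<le> \<delta> * x" using small[of l] e that by auto
          also have "\<dots> \<le> \<delta> * (C * e k)" using False \<delta>(1) by (intro mult_left_mono) auto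
          also have "\<dots> = r * e k" using \<delta>(2) by (simp add: mult.assoc[symmetric] mult.commute)
          also have "\<dots> \<le> s k * e k" using r(3)[OF k] ek by (intro mult_right_mono) auto
          finally show ?thesis .
        qed
        then have "\<bar>F e - a k * e k\<bar> \<le> \<eta> * e k" using s(2)[of k e, OF k ek] by blast
        then have "(a k - \<eta>) * e k \<le> F e" "F e \<le> (a k + \<eta>) * e k"
          by (auto simp: abs_le_iff algebra_simps)
        moreover have "(a k - \<eta>) * e k \<le> a k * e k" "a k * e k \<le> (a k + \<eta>) * e k"
          using ek \<eta> by (auto intro!: mult_right_mono)
        \<comment> \<open>Both \<open>F e\<close> and \<open>a k * e k\<close> lie between
          \<open>(a k - \<eta>) * e k\<close> and \<open>(a k + \<eta>) * e k\<close>, so their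
          indicators can differ only if x separates these two ends.\<close>
        ultimately have "?L \<le> of_bool ((a k + \<eta>) * e k > x) - of_bool ((a k - \<eta>) * e k > x)"
          unfolding L by auto
        also have "\<dots> \<le> ?S"
          by (rule member_le_sum[OF k _ K(1)]) (use S_term in blast)
        finally show ?thesis using D by (simp add: add_increasing2)
      qed
    qed
  qed
  then show ?thesis unfolding a_def by (rule that[OF \<delta>(1)])
qed

section \<open>Asymptotics of the noise tail\<close>

text \<open>Asymptotically equivalent functions eventually have the same zeros, and the regularly
  varying comparison function eventually has none.\<close>

lemma regularly_varying_tail_pos:
  assumes "regularly_varying_tail M Y \<alpha>"
  shows "eventually (\<lambda>x. 0 < measure M {\<omega> \<in> space M. Y \<omega> > x}) at_top"
proof -
  obtain l where l: "slowly_varying l"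
      "(\<lambda>x. measure M {\<omega> \<in> space M. Y \<omega> > x}) \<sim>[at_top] (\<lambda>x. l x * x powr (- \<alpha>))"
    using assms unfolding regularly_varying_tail_def by blast
  have "eventually (\<lambda>x. measure M {\<omega> \<in> space M. Y \<omega> > x} = 0 \<longleftrightarrow> l x * x powr (- \<alpha>) = 0) at_top"
    using l(2) by (rule asymp_equiv_eventually_zeros)
  moreover have "eventually (\<lambda>x. 0 < l x) at_top" using l(1) by (simp add: slowly_varying_def)
  ultimately show ?thesis
    using eventually_gt_at_top[of 0]
    by eventually_elim (auto simp: zero_less_measure_iff)
qed

text \<open>The tail is compared with l(x) x^(-\<alpha>) both at x and at t x. Both comparison
  ratios tend to 1, and slow variation leaves only the power of t.\<close>

lemma regularly_varying_tail_ratio: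
  assumes Y: "regularly_varying_tail M Y \<alpha>" and t: "0 < t"
  shows "((\<lambda>x. measure M {\<omega> \<in> space M. Y \<omega> > t * x} / measure M {\<omega> \<in> space M. Y \<omega> > x})
    \<longlongrightarrow> t powr (- \<alpha>)) at_top"
proof -
  define H where "H x = measure M {\<omega> \<in> space M. Y \<omega> > x}" for x
  obtain l where l: "slowly_varying l" "H \<sim>[at_top] (\<lambda>x. l x * x powr (- \<alpha>))"
    using Y unfolding regularly_varying_tail_def H_def by blast
  define g where "g x = l x * x powr (- \<alpha>)" for x
  have l_pos: "eventually (\<lambda>x. 0 < l x) at_top" using l(1) by (simp add: slowly_varying_def)
  then have g_pos: "eventually (\<lambda>x. 0 < g x) at_top"
    using eventually_gt_at_top[of 0] unfolding g_def by eventually_elim simp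
  have scale: "filterlim (\<lambda>x. t * x) at_top at_top"
    using t by (intro filterlim_tendsto_pos_mult_at_top[OF tendsto_const _ filterlim_ident])
  have Hg: "((\<lambda>x. H x / g x) \<longlongrightarrow> 1) at_top"
  \<comment> \<open>Asymptotic equivalence assigns the ratio 1 to a common zero; positivity of
    \<open>g\<close> excludes that case.\<close>
  proof (rule Lim_transform_eventually[OF asymp_equivD[OF l(2)]])
    show "\<forall>\<^sub>F x in at_top. (if H x = 0 \<and> l x * x powr - \<alpha> = 0 then 1
        else H x / (l x * x powr - \<alpha>)) = H x / g x"
      using g_pos by eventually_elim (auto simp: g_def)
  qed
  have Hg_t: "((\<lambda>x. H (t * x) / g (t * x)) \<longlongrightarrow> 1) at_top"
    by (rule filterlim_compose[OF Hg scale])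
  have "((\<lambda>x. l (t * x) / l x * t powr (- \<alpha>)) \<longlongrightarrow> 1 * t powr (- \<alpha>)) at_top"
    using l(1) t unfolding slowly_varying_def by (intro tendsto_mult tendsto_const) blast
  from tendsto_divide[OF tendsto_mult[OF Hg_t this] Hg]
  have "((\<lambda>x. (H (t * x) / g (t * x)) * (l (t * x) / l x * t powr (- \<alpha>)) / (H x / g x))
      \<longlongrightarrow> 1 * (1 * t powr (- \<alpha>)) / 1) at_top"
    by simp
  then have "((\<lambda>x. H (t * x) / H x) \<longlongrightarrow> 1 * (1 * t powr (- \<alpha>)) / 1) at_top"
  proof (rule Lim_transform_eventually)
    have "eventually (\<lambda>x. 0 < g (t * x)) at_top"
      using g_pos scale unfolding filterlim_iff by blast
    then show "\<forall>\<^sub>F x in at_top. (H (t * x) / g (t * x)) * (l (t * x) / l x * t powr (- \<alpha>)) /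
        (H x / g x) = H (t * x) / H x"
      using g_pos l_pos eventually_gt_at_top[of 0]
    proof eventually_elim
      case (elim x)
      have "l (t * x) / l x * t powr (- \<alpha>) = g (t * x) / g x"
        using elim t by (simp add: g_def powr_mult)
      then show ?case using elim by simp
    qed
  qed
  then show ?thesis by (simp add: H_def)
qed

context ht_hscm
begin

text \<open>The noises are identically distributed, so node 1 represents them all; it exists as soon
  as some node does.\<close>

definition noise_survival :: "real \<Rightarrow> real"
  where "noise_survival x = prob {\<omega> \<in> space M. \<epsilon> 1 \<omega> > x}"

lemma noise_measurable [measurable]:
  "k \<in> {1..d} \<Longrightarrow> random_variable borel (\<epsilon> k)"
  using noise_indep by (auto simp: indep_vars_def)

lemma prob_noise:
  assumes k: "k \<in> {1..d}"
  shows "prob {\<omega> \<in> space M. \<epsilon> k \<omega> > x} = noise_survival x"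
proof -
  have one: "1 \<in> {1..d}" using k by simp
  have "prob {\<omega> \<in> space M. \<epsilon> i \<omega> > x} = measure (distr M borel (\<epsilon> i)) {x<..}"
    if "i \<in> {1..d}" for i
    using noise_measurable[OF that]
    by (subst measure_distr) (auto intro!: arg_cong[where f = prob])
  then show ?thesis
    using noise_ident[OF k one] k one by (simp add: noise_survival_def)
qed

lemma prob_scaled_noise:
  assumes "k \<in> {1..d}" "0 < c"
  shows "prob {\<omega> \<in> space M. c * \<epsilon> k \<omega> > x} = noise_survival (inverse c * x)"
proof -
  have "{\<omega> \<in> space M. c * \<epsilon> k \<omega> > x} = {\<omega> \<in> space M. \<epsilon> k \<omega> > inverse c * x}"
    using assms(2) by (auto simp: field_simps)
  then show ?thesis using prob_noise[OF assms(1)] by simp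
qed

lemma prob_two_noises:
  assumes "k \<in> {1..d}" "l \<in> {1..d}" "k \<noteq> l"
  shows "prob {\<omega> \<in> space M. \<epsilon> k \<omega> > x \<and> \<epsilon> l \<omega> > x} = noise_survival x * noise_survival x"
proof -
  have "prob (\<Inter>i\<in>{k, l}. \<epsilon> i -` {x<..} \<inter> space M) = (\<Prod>i\<in>{k, l}. prob (\<epsilon> i -` {x<..} \<inter> space M))"
    using assms by (intro indep_varsD[OF noise_indep]) auto
  moreover have "(\<Inter>i\<in>{k, l}. \<epsilon> i -` {x<..} \<inter> space M) = {\<omega> \<in> space M. \<epsilon> k \<omega> > x \<and> \<epsilon> l \<omega> > x}"
    by auto
  moreover have "\<epsilon> i -` {x<..} \<inter> space M = {\<omega> \<in> space M. \<epsilon> i \<omega> > x}" for i by auto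
  ultimately show ?thesis using assms prob_noise by simp
qed

lemma noise_survival_pos:
  "1 \<le> d \<Longrightarrow> eventually (\<lambda>x. 0 < noise_survival x) at_top"
  using regularly_varying_tail_pos[OF noise_tail[of 1]] by (simp add: noise_survival_def)

lemma noise_survival_ratio:
  assumes "1 \<le> d" "0 < c"
  shows "((\<lambda>x. noise_survival (inverse c * x) / noise_survival x) \<longlongrightarrow> c powr \<alpha>) at_top"
  using regularly_varying_tail_ratio[OF noise_tail[of 1], of "inverse c"] assms
  by (simp add: noise_survival_def powr_minus inverse_powr)

text \<open>This makes two simultaneous large noises, whose probability is a product of two survival
  functions, negligible against one.\<close>

lemma noise_survival_tendsto_0:
  assumes "1 \<le> d"
  shows "(noise_survival \<longlongrightarrow> 0) at_top"
proof -
  have m: "random_variable borel (\<epsilon> 1)" using assms by (intro noise_measurable) simp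
  interpret D: real_distribution "distr M borel (\<epsilon> 1)" by (rule real_distribution_distr) fact
  have "((\<lambda>x. 1 - cdf (distr M borel (\<epsilon> 1)) x) \<longlongrightarrow> 1 - 1) at_top"
    by (intro tendsto_intros D.cdf_lim_at_top_prob)
  moreover have "1 - cdf (distr M borel (\<epsilon> 1)) x = noise_survival x" for x
  proof -
    have "cdf (distr M borel (\<epsilon> 1)) x = prob {\<omega> \<in> space M. \<epsilon> 1 \<omega> \<le> x}"
      unfolding cdf_def2 by (subst measure_distr[OF m]) (auto intro!: arg_cong[where f = prob])
    moreover have "prob {\<omega> \<in> space M. \<not> \<epsilon> 1 \<omega> \<le> x} = 1 - prob {\<omega> \<in> space M. \<epsilon> 1 \<omega> \<le> x}"
      using measurable_sets[OF m, of "{..x}"]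
      by (intro prob_neg) (simp add: vimage_def Int_def conj_commute)
    ultimately show ?thesis by (simp add: noise_survival_def not_le)
  qed
  ultimately show ?thesis by simp
qed

section \<open>The big jump estimate in expectation\<close>

lemma Ancestors_subset: "i \<in> {1..d} \<Longrightarrow> Ancestors E i \<subseteq> {1..d}"
  using trancl_subset_Sigma[OF edges] unfolding Ancestors_def ancestors_def by blast

lemma finite_Ancestors: "i \<in> {1..d} \<Longrightarrow> finite (Ancestors E i)"
  using Ancestors_subset finite_subset by blast

text \<open>The pointwise bound survives multiplication by \<open>Z\<close>, since \<open>Z\<close>
  is bounded by 1, and its right side integrates to survival functions. After division by
  \<open>noise_survival x\<close>, the joint exceedances vanish in the limit and the remaining error
  is small with \<eta>.\<close>

lemma single_big_jump:
  assumes j: "j \<in> {1..d}" and F: "aggregating (Ancestors E j) F"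
    and XF: "AE \<omega> in M. X j \<omega> = F (\<lambda>k. \<epsilon> k \<omega>)"
    and Z [measurable]: "random_variable borel Z" and Z_bound: "\<And>\<omega>. \<bar>Z \<omega>\<bar> \<le> 1"
  shows "((\<lambda>x. (expectation (\<lambda>\<omega>. Z \<omega> * indicat_real {\<omega> \<in> space M. X j \<omega> > x} \<omega>) -
      (\<Sum>k\<in>Ancestors E j. expectation (\<lambda>\<omega>. Z \<omega> *
        indicat_real {\<omega> \<in> space M. F (unit_noise k) * \<epsilon> k \<omega> > x} \<omega>))) / noise_survival x)
    \<longlongrightarrow> 0) at_top"
proof -
  define K where "K = Ancestors E j"
  define a where "a k = F (unit_noise k)" for k
  have d: "1 \<le> d" using j by auto
  have K: "finite K" "K \<noteq> {}" "K \<subseteq> {1..d}"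
    using j finite_Ancestors Ancestors_subset by (auto simp: K_def Ancestors_def)
  have a_pos: "0 < a k" if "k \<in> K" for k
    using aggregating_unit_pos[OF F] that by (simp add: a_def K_def)
  define R where "R x = expectation (\<lambda>\<omega>. Z \<omega> * indicat_real {\<omega> \<in> space M. X j \<omega> > x} \<omega>) -
      (\<Sum>k\<in>K. expectation (\<lambda>\<omega>. Z \<omega> * indicat_real {\<omega> \<in> space M. a k * \<epsilon> k \<omega> > x} \<omega>))" for x
  have noise_nonneg_K: "AE \<omega> in M. \<forall>k\<in>K. 0 \<le> \<epsilon> k \<omega>"
    using noise_nonneg K(3) by (intro AE_finite_allI[OF K(1)]) blast
  \<comment> \<open>The condition \<open>\<eta> < a k\<close> keeps the lower factor
    \<open>a k - \<eta>\<close> positive, so that its event is again an exceedance by the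
    noise.\<close>
  have bound: "\<exists>\<delta>>0. \<forall>x>0. \<bar>R x\<bar> \<le>
      (\<Sum>k\<in>K. noise_survival (inverse (a k + \<eta>) * x) - noise_survival (inverse (a k - \<eta>) * x)) +
      (card K + 1) * (\<Sum>k\<in>K. \<Sum>l\<in>K - {k}. noise_survival (\<delta> * x) * noise_survival (\<delta> * x))"
    if \<eta>: "0 < \<eta>" "\<And>k. k \<in> K \<Longrightarrow> \<eta> < a k" for \<eta>
  proof (rule single_big_jump_pointwise[OF F[folded K_def] K(1,2) \<eta>(1), folded a_def])
    fix \<delta> :: real
    assume \<delta>: "0 < \<delta>"
      "\<And>x e. 0 < x \<Longrightarrow> (\<forall>k\<in>K. 0 \<le> e k) \<Longrightarrow>
        \<bar>of_bool (F e > x) - (\<Sum>k\<in>K. of_bool (a k * e k > x))\<bar> \<le>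
        (\<Sum>k\<in>K. of_bool ((a k + \<eta>) * e k > x) - of_bool ((a k - \<eta>) * e k > x)) +
        (card K + 1) * (\<Sum>k\<in>K. \<Sum>l\<in>K - {k}. of_bool (e k > \<delta> * x \<and> e l > \<delta> * x) :: real)"
    have "\<bar>R x\<bar> \<le>
      (\<Sum>k\<in>K. noise_survival (inverse (a k + \<eta>) * x) - noise_survival (inverse (a k - \<eta>) * x)) +
      (card K + 1) * (\<Sum>k\<in>K. \<Sum>l\<in>K - {k}. noise_survival (\<delta> * x) * noise_survival (\<delta> * x))"
      if x: "0 < x" for x
    proof -
      let ?I = "\<lambda>P \<omega>. indicat_real {\<omega> \<in> space M. P \<omega>} \<omega>"
      define D where "D \<omega> = ?I (\<lambda>\<omega>. X j \<omega> > x) \<omega> - (\<Sum>k\<in>K. ?I (\<lambda>\<omega>. a k * \<epsilon> k \<omega> > x) \<omega>)" for \<omega>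
      define B where "B \<omega> = (\<Sum>k\<in>K. ?I (\<lambda>\<omega>. (a k + \<eta>) * \<epsilon> k \<omega> > x) \<omega> -
          ?I (\<lambda>\<omega>. (a k - \<eta>) * \<epsilon> k \<omega> > x) \<omega>) +
        (card K + 1) * (\<Sum>k\<in>K. \<Sum>l\<in>K - {k}. ?I (\<lambda>\<omega>. \<epsilon> k \<omega> > \<delta> * x \<and> \<epsilon> l \<omega> > \<delta> * x) \<omega>)" for \<omega>
      have Z_int: "has_bochner_integral M (\<lambda>\<omega>. Z \<omega> * ?I P \<omega>) (expectation (\<lambda>\<omega>. Z \<omega> * ?I P \<omega>))"
        if [measurable]: "Measurable.pred M P" for P
      proof (rule has_bochner_integral_integrable)
        show "integrable M (\<lambda>\<omega>. Z \<omega> * ?I P \<omega>)"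
          by (rule integrable_const_bound[where B = 1])
            (use Z_bound in \<open>auto simp: indicator_def\<close>)
      qed
      have I_int: "has_bochner_integral M (?I P) (prob {\<omega> \<in> space M. P \<omega>})"
        if [measurable]: "Measurable.pred M P" for P
        by (rule has_bochner_integral_real_indicator) (auto simp: emeasure_eq_measure)
      have two_pred: "Measurable.pred M (\<lambda>\<omega>. \<epsilon> k \<omega> > c \<and> \<epsilon> l \<omega> > c)"
        if "k \<in> K" "l \<in> K - {k}" for k l c
      proof -
        have [measurable]: "random_variable borel (\<epsilon> k)" "random_variable borel (\<epsilon> l)"
          using that K(3) noise_measurable by blast+
        show ?thesis by measurable
      qed
      have one_pred: "Measurable.pred M (\<lambda>\<omega>. b * \<epsilon> k \<omega> > c)" if "k \<in> K" for k b c
      proof -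
        have [measurable]: "random_variable borel (\<epsilon> k)"
          using that K(3) noise_measurable by blast
        show ?thesis by measurable
      qed
      have X_pred: "Measurable.pred M (\<lambda>\<omega>. X j \<omega> > x)"
        using X_measurable[OF j] by measurable
      have B_int: "has_bochner_integral M B
          ((\<Sum>k\<in>K. prob {\<omega> \<in> space M. (a k + \<eta>) * \<epsilon> k \<omega> > x} - prob {\<omega> \<in> space M. (a k - \<eta>) * \<epsilon> k \<omega> > x}) +
          (card K + 1) * (\<Sum>k\<in>K. \<Sum>l\<in>K - {k}. prob {\<omega> \<in> space M. \<epsilon> k \<omega> > \<delta> * x \<and> \<epsilon> l \<omega> > \<delta> * x}))"
        unfolding B_def
        by (intro has_bochner_integral_add has_bochner_integral_sum has_bochner_integral_diff
            has_bochner_integral_mult_right I_int two_pred one_pred)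
      have ZD_int: "has_bochner_integral M (\<lambda>\<omega>. Z \<omega> * D \<omega>) (R x)"
        unfolding R_def D_def right_diff_distrib sum_distrib_left
        by (intro has_bochner_integral_sum has_bochner_integral_diff Z_int X_pred one_pred)
      note R_eq = has_bochner_integral_integral_eq[OF ZD_int, symmetric]
      have "\<bar>R x\<bar> \<le> expectation (\<lambda>\<omega>. \<bar>Z \<omega> * D \<omega>\<bar>)"
        unfolding R_eq by (rule integral_abs_bound)
      also have "\<dots> \<le> expectation B"
      proof (rule integral_mono_AE)
        show "integrable M (\<lambda>\<omega>. \<bar>Z \<omega> * D \<omega>\<bar>)" using ZD_int by (simp add: has_bochner_integral_iff)
        show "AE \<omega> in M. \<bar>Z \<omega> * D \<omega>\<bar> \<le> B \<omega>"
          using noise_nonneg_K XF AE_space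
        proof eventually_elim
          case (elim \<omega>)
          have "\<bar>Z \<omega> * D \<omega>\<bar> \<le> 1 * \<bar>D \<omega>\<bar>"
            unfolding abs_mult using Z_bound by (intro mult_right_mono) auto
          also have "\<dots> \<le> B \<omega>"
            using \<delta>(2)[OF x, of "\<lambda>k. \<epsilon> k \<omega>"] elim
            by (simp add: D_def B_def indicator_def of_bool_def)
          finally show ?case .
        qed
      qed (use B_int in \<open>simp add: has_bochner_integral_iff\<close>)
      also have "expectation B =
          (\<Sum>k\<in>K. prob {\<omega> \<in> space M. (a k + \<eta>) * \<epsilon> k \<omega> > x} - prob {\<omega> \<in> space M. (a k - \<eta>) * \<epsilon> k \<omega> > x}) +
          (card K + 1) * (\<Sum>k\<in>K. \<Sum>l\<in>K - {k}. prob {\<omega> \<in> space M. \<epsilon> k \<omega> > \<delta> * x \<and> \<epsilon> l \<omega> > \<delta> * x})"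
        by (rule has_bochner_integral_integral_eq[OF B_int])
      also have "\<dots> = (\<Sum>k\<in>K. noise_survival (inverse (a k + \<eta>) * x) - noise_survival (inverse (a k - \<eta>) * x)) +
          (card K + 1) * (\<Sum>k\<in>K. \<Sum>l\<in>K - {k}. noise_survival (\<delta> * x) * noise_survival (\<delta> * x))"
      proof -
        have "prob {\<omega> \<in> space M. (a k + \<eta>) * \<epsilon> k \<omega> > x} = noise_survival (inverse (a k + \<eta>) * x)"
            "prob {\<omega> \<in> space M. (a k - \<eta>) * \<epsilon> k \<omega> > x} = noise_survival (inverse (a k - \<eta>) * x)"
          if "k \<in> K" for k
          using that K(3) \<eta> a_pos[OF that] by (auto intro!: prob_scaled_noise)
        moreover have "prob {\<omega> \<in> space M. \<epsilon> k \<omega> > \<delta> * x \<and> \<epsilon> l \<omega> > \<delta> * x} =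
            noise_survival (\<delta> * x) * noise_survival (\<delta> * x)"
          if "k \<in> K" "l \<in> K - {k}" for k l
          using that K(3) by (intro prob_two_noises) auto
        ultimately show ?thesis by (auto intro!: sum.cong simp del: sum_constant)
      qed
      finally show ?thesis .
    qed
    then show "\<exists>\<delta>>0. \<forall>x>0. \<bar>R x\<bar> \<le>
      (\<Sum>k\<in>K. noise_survival (inverse (a k + \<eta>) * x) - noise_survival (inverse (a k - \<eta>) * x)) +
      (card K + 1) * (\<Sum>k\<in>K. \<Sum>l\<in>K - {k}. noise_survival (\<delta> * x) * noise_survival (\<delta> * x))"
      using \<delta>(1) by (intro exI[of _ \<delta>] conjI allI impI)
  qed
  have "((\<lambda>x. R x / noise_survival x) \<longlongrightarrow> 0) at_top"
  proof (rule tendstoI)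
    fix \<tau> :: real
    assume "0 < \<tau>"
    have "((\<lambda>\<eta>. \<Sum>k\<in>K. (a k + \<eta>) powr \<alpha> - (a k - \<eta>) powr \<alpha>) \<longlongrightarrow>
        (\<Sum>k\<in>K. (a k + 0) powr \<alpha> - (a k - 0) powr \<alpha>)) (at_right 0)"
      by (intro tendsto_intros) (use a_pos in force)+
    then have "\<forall>\<^sub>F \<eta> in at_right 0. (\<Sum>k\<in>K. (a k + \<eta>) powr \<alpha> - (a k - \<eta>) powr \<alpha>) < \<tau>"
      using \<open>0 < \<tau>\<close> by (intro order_tendstoD(2)) auto
    moreover have "\<forall>\<^sub>F \<eta> in at_right 0. \<forall>k\<in>K. \<eta> < a k"
      using K(1) a_pos by (auto intro!: eventually_ball_finite order_tendstoD(2)[OF tendsto_ident_at])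
    moreover have "\<forall>\<^sub>F \<eta> in at_right (0::real). 0 < \<eta>"
      by (rule eventually_at_right_less)
    ultimately have "\<forall>\<^sub>F \<eta> in at_right 0. 0 < \<eta> \<and> (\<forall>k\<in>K. \<eta> < a k) \<and>
        (\<Sum>k\<in>K. (a k + \<eta>) powr \<alpha> - (a k - \<eta>) powr \<alpha>) < \<tau>"
      by eventually_elim auto
    then obtain \<eta> where \<eta>: "0 < \<eta>" "\<And>k. k \<in> K \<Longrightarrow> \<eta> < a k"
        "(\<Sum>k\<in>K. (a k + \<eta>) powr \<alpha> - (a k - \<eta>) powr \<alpha>) < \<tau>"
      using eventually_happens'[OF trivial_limit_at_right_real] by blast
    obtain \<delta> where \<delta>: "0 < \<delta>" "\<And>x. 0 < x \<Longrightarrow> \<bar>R x\<bar> \<le>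
      (\<Sum>k\<in>K. noise_survival (inverse (a k + \<eta>) * x) - noise_survival (inverse (a k - \<eta>) * x)) +
      (card K + 1) * (\<Sum>k\<in>K. \<Sum>l\<in>K - {k}. noise_survival (\<delta> * x) * noise_survival (\<delta> * x))"
      using bound[OF \<eta>(1,2)] by blast
    \<comment> \<open>This is the bound on \<open>R x\<close> divided by
      \<open>noise_survival x\<close>. In each product only one factor absorbs the division, and the
      other tends to 0.\<close>
    define T where "T x =
      (\<Sum>k\<in>K. noise_survival (inverse (a k + \<eta>) * x) / noise_survival x -
        noise_survival (inverse (a k - \<eta>) * x) / noise_survival x) +
      (card K + 1) * (\<Sum>k\<in>K. \<Sum>l\<in>K - {k}.
        noise_survival (\<delta> * x) / noise_survival x * noise_survival (\<delta> * x))" for x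
    have "filterlim (\<lambda>x. \<delta> * x) at_top at_top"
      using \<delta>(1) by (intro filterlim_tendsto_pos_mult_at_top[OF tendsto_const _ filterlim_ident])
    then have "((\<lambda>x. noise_survival (\<delta> * x)) \<longlongrightarrow> 0) at_top"
      by (rule filterlim_compose[OF noise_survival_tendsto_0[OF d]])
    moreover have "((\<lambda>x. noise_survival (\<delta> * x) / noise_survival x) \<longlongrightarrow> inverse \<delta> powr \<alpha>) at_top"
      using noise_survival_ratio[OF d, of "inverse \<delta>"] \<delta>(1) by simp
    ultimately have "(T \<longlongrightarrow> (\<Sum>k\<in>K. (a k + \<eta>) powr \<alpha> - (a k - \<eta>) powr \<alpha>) +
        (card K + 1) * (\<Sum>k\<in>K. \<Sum>l\<in>K - {k}. inverse \<delta> powr \<alpha> * 0)) at_top"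
      unfolding T_def using \<eta> a_pos
      by (intro tendsto_intros noise_survival_ratio d) (force intro: add_pos_pos)+
    then have "\<forall>\<^sub>F x in at_top. T x < \<tau>"
      using \<eta>(3) by (intro order_tendstoD(2)) auto
    then show "\<forall>\<^sub>F x in at_top. dist (R x / noise_survival x) 0 < \<tau>"
      using noise_survival_pos[OF d] eventually_gt_at_top[of 0]
    proof eventually_elim
      case (elim x)
      have "\<bar>R x\<bar> / noise_survival x \<le> ((\<Sum>k\<in>K. noise_survival (inverse (a k + \<eta>) * x) - noise_survival (inverse (a k - \<eta>) * x)) +
      (card K + 1) * (\<Sum>k\<in>K. \<Sum>l\<in>K - {k}. noise_survival (\<delta> * x) * noise_survival (\<delta> * x))) / noise_survival x"
        using \<delta>(2)[of x] elim by (intro divide_right_mono) auto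
      also have "\<dots> = T x"
        by (simp add: T_def add_divide_distrib sum_divide_distrib diff_divide_distrib)
      finally show ?case using elim by (simp add: dist_real_def)
    qed
  qed
  then show ?thesis by (simp add: R_def K_def a_def)
qed

end

section \<open>Limits of the conditional expectations\<close>

lemma (in real_distribution) expectation_cdf_continuous:
  assumes "continuous_on UNIV (cdf M)"
  shows "expectation (cdf M) = 1 / 2"
proof -
  interpret P: pair_prob_space M M ..
  have atom: "measure M {x} = 0" for x
    using assms isCont_cdf[of x] by (simp add: continuous_on_eq_continuous_at)
  \<comment> \<open>For an independent copy \<open>Y\<close> of \<open>X\<close>, exchangeability gives \<open>P(Y \<le> X) = P(X \<le> Y)\<close>,
    and ties are null.\<close>
  define A where "A = {p \<in> space (M \<Otimes>\<^sub>M M). snd p \<le> (fst p :: real)}"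
  have A [measurable]: "A \<in> sets (M \<Otimes>\<^sub>M M)" unfolding A_def by measurable
  have mono_meas: "mono (\<lambda>x. measure M {..x})" "mono (\<lambda>x. - measure M {x..})"
    by (auto intro!: monoI finite_measure_mono)
  have [measurable]: "(\<lambda>x. measure M {..x}) \<in> borel_measurable M"
    "(\<lambda>x. measure M {x..}) \<in> borel_measurable M"
    using borel_measurable_mono[OF mono_meas(1)] borel_measurable_mono[OF mono_meas(2)]
    by (auto simp: borel_measurable_uminus_eq)
  have int: "integrable M (\<lambda>x. measure M {..x})" "integrable M (\<lambda>x. measure M {x..})"
    by (rule integrable_const_bound[where B = 1]; simp)+
  \<comment> \<open>Slicing \<open>A\<close> at its first coordinate gives \<open>{..x}\<close>, at
    its second \<open>{x..}\<close>.\<close>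
  have "(\<integral>\<^sup>+ x. ennreal (measure M {..x}) \<partial>M) = emeasure (M \<Otimes>\<^sub>M M) A"
    by (subst emeasure_pair_measure_alt[OF A])
      (auto simp: A_def space_pair_measure vimage_def atMost_def emeasure_eq_measure)
  also have "\<dots> = (\<integral>\<^sup>+ x. ennreal (measure M {x..}) \<partial>M)"
    by (subst P.emeasure_pair_measure_alt2[OF A])
      (auto simp: A_def space_pair_measure vimage_def atLeast_def emeasure_eq_measure)
  finally have eq: "expectation (\<lambda>x. measure M {..x}) = expectation (\<lambda>x. measure M {x..})"
    by (simp add: integral_eq_nn_integral)
  have "measure M {..x} + measure M {x..} = 1" for x
  proof -
    have "measure M ({..<x} \<union> {x}) = measure M {..<x} + measure M {x}"
      by (intro finite_measure_Union) auto
    moreover have "{..<x} \<union> {x} = {..x}" by auto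
    moreover have "measure M ({..<x} \<union> {x..}) = measure M {..<x} + measure M {x..}"
      by (intro finite_measure_Union) auto
    moreover have "{..<x} \<union> {x..} = space M" by auto
    ultimately show ?thesis using atom prob_space by simp
  qed
  then have "expectation (\<lambda>x. measure M {..x} + measure M {x..}) = 1"
    using prob_space by simp
  then show ?thesis using eq int by (simp add: cdf_def2[abs_def])
qed

context ht_hscm
begin

text \<open>In this form the rank is an admissible weight \<open>Z\<close>, with values in [-1, 1].
  The centring gives it mean 0, which is why independent jumps contribute nothing.\<close>

definition centred_rank :: "nat \<Rightarrow> 'a \<Rightarrow> real"
  where "centred_rank i \<omega> = 2 * cdf (distr M borel (X i)) (X i \<omega>) - 1"

lemma real_distribution_X: "i \<in> {1..d} \<Longrightarrow> real_distribution (distr M borel (X i))"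
  by (intro real_distribution_distr X_measurable)

lemma cdf_X_measurable:
  assumes "i \<in> {1..d}"
  shows "cdf (distr M borel (X i)) \<in> borel_measurable borel"
  by (intro borel_measurable_continuous_onI continuous_marginal assms)

lemma centred_rank_measurable [measurable]:
  "i \<in> {1..d} \<Longrightarrow> random_variable borel (centred_rank i)"
  unfolding centred_rank_def
  by (intro borel_measurable_diff borel_measurable_times borel_measurable_const
      measurable_compose[OF X_measurable cdf_X_measurable])

lemma centred_rank_bound:
  assumes "i \<in> {1..d}"
  shows "\<bar>centred_rank i \<omega>\<bar> \<le> 1"
proof -
  interpret D: real_distribution "distr M borel (X i)" using assms by (rule real_distribution_X)
  show ?thesis
    using D.cdf_bounded_prob[of "X i \<omega>"] D.cdf_nonneg[of "X i \<omega>"] by (simp add: centred_rank_def)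
qed

lemma expectation_centred_rank:
  assumes i: "i \<in> {1..d}"
  shows "expectation (centred_rank i) = 0"
proof -
  interpret D: real_distribution "distr M borel (X i)" using i by (rule real_distribution_X)
  have "expectation (\<lambda>\<omega>. cdf (distr M borel (X i)) (X i \<omega>)) = 1 / 2"
    using D.expectation_cdf_continuous[OF continuous_marginal[OF i]]
    by (simp add: integral_distr[OF X_measurable[OF i] cdf_X_measurable[OF i]])
  moreover have "integrable M (\<lambda>\<omega>. cdf (distr M borel (X i)) (X i \<omega>))"
    using D.cdf_bounded_prob D.cdf_nonneg measurable_compose[OF X_measurable[OF i] cdf_X_measurable[OF i]]
    by (intro integrable_const_bound[where B = 1]) auto
  ultimately show ?thesis by (simp add: centred_rank_def[abs_def] prob_space)
qed

section \<open>Contribution of a single noise to the numerator\<close>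

text \<open>Almost surely the rank is a measurable function of the noises of
  \<open>Ancestors E i\<close>, a block disjoint from k. The expectation factorises, and the rank
  has mean 0.\<close>

lemma expectation_rank_non_ancestor:
  assumes i: "i \<in> {1..d}" and k: "k \<in> {1..d}" "k \<notin> Ancestors E i"
  shows "expectation (\<lambda>\<omega>. centred_rank i \<omega> * indicat_real {\<omega> \<in> space M. c * \<epsilon> k \<omega> > x} \<omega>) = 0"
proof -
  define A where "A = Ancestors E i"
  define G where "G = cdf (distr M borel (X i))"
  obtain F where F: "aggregating A F" and XF: "AE \<omega> in M. X i \<omega> = F (\<lambda>k. \<epsilon> k \<omega>)"
    using noise_representation[OF i] unfolding A_def by metis
  \<comment> \<open>Independence of blocks concerns vectors indexed by \<open>A\<close>, whereas
    \<open>F\<close> takes a full sequence. Padding with zeros bridges the two, because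
    \<open>F\<close> reads only \<open>A\<close>.\<close>
  define ext where "ext v = (\<lambda>l. if l \<in> A then v l else 0)" for v :: "nat \<Rightarrow> real"
  have G_meas: "G \<in> borel_measurable borel" using cdf_X_measurable[OF i] by (simp add: G_def)
  have "ext \<in> measurable (Pi\<^sub>M A (\<lambda>_. borel)) (Pi\<^sub>M UNIV (\<lambda>_. borel))"
    unfolding ext_def
  proof (rule measurable_PiM_single')
    fix l
    show "(\<lambda>v. if l \<in> A then v l else 0 :: real) \<in> measurable (Pi\<^sub>M A (\<lambda>_. borel)) borel"
      by (cases "l \<in> A") auto
  qed auto
  \<comment> \<open>On this countable product the product sigma-algebra is the Borel one, which
    makes the continuous \<open>F\<close> composable with \<open>ext\<close>.\<close>
  then have ext_meas: "ext \<in> measurable (Pi\<^sub>M A (\<lambda>_. borel)) borel"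
    by (simp add: measurable_cong_sets[OF refl sets_PiM_equal_borel])
  have F_meas: "F \<in> borel_measurable borel"
    using F by (intro borel_measurable_continuous_onI) (simp add: aggregating_def)
  define Y1 where "Y1 v = 2 * G (F (ext v)) - 1" for v
  define Y2 where "Y2 v = indicat_real {x<..} (c * v k)" for v :: "nat \<Rightarrow> real"
  define W1 where "W1 \<omega> = Y1 (restrict (\<lambda>l. \<epsilon> l \<omega>) A)" for \<omega>
  define W2 where "W2 \<omega> = Y2 (restrict (\<lambda>l. \<epsilon> l \<omega>) {k})" for \<omega>
  have Y1_meas: "Y1 \<in> borel_measurable (Pi\<^sub>M A (\<lambda>_. borel))"
    unfolding Y1_def
    using measurable_compose[OF measurable_compose[OF ext_meas F_meas] G_meas]
    by (intro borel_measurable_diff borel_measurable_times borel_measurable_const)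
  have Y2_meas: "Y2 \<in> borel_measurable (Pi\<^sub>M {k} (\<lambda>_. borel))"
    unfolding Y2_def by measurable
  have "indep_var (Pi\<^sub>M A (\<lambda>_. borel)) (\<lambda>\<omega>. restrict (\<lambda>l. \<epsilon> l \<omega>) A)
      (Pi\<^sub>M {k} (\<lambda>_. borel)) (\<lambda>\<omega>. restrict (\<lambda>l. \<epsilon> l \<omega>) {k})"
    using k Ancestors_subset[OF i] by (intro indep_var_restrict[OF noise_indep]) (auto simp: A_def)
  from indep_var_compose[OF this Y1_meas Y2_meas]
  have indep: "indep_var borel W1 borel W2" by (simp add: comp_def W1_def[abs_def] W2_def[abs_def])
  have W1: "AE \<omega> in M. centred_rank i \<omega> = W1 \<omega>"
    using XF
  proof eventually_elim
    case (elim \<omega>)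
    have "F (ext (restrict (\<lambda>l. \<epsilon> l \<omega>) A)) = F (\<lambda>l. \<epsilon> l \<omega>)"
      using F unfolding aggregating_def ext_def by auto
    then show ?case using elim by (simp add: centred_rank_def W1_def Y1_def G_def)
  qed
  have W2: "indicat_real {\<omega> \<in> space M. c * \<epsilon> k \<omega> > x} \<omega> = W2 \<omega>" if "\<omega> \<in> space M" for \<omega>
    using that by (simp add: W2_def Y2_def indicator_def)
  note [measurable] = indep_var_rv1[OF indep] indep_var_rv2[OF indep] noise_measurable[OF k(1)]
    centred_rank_measurable[OF i]
  have W1_bound: "AE \<omega> in M. \<bar>W1 \<omega>\<bar> \<le> 1"
    using W1 by eventually_elim (use centred_rank_bound[OF i] in metis)
  have int1: "integrable M W1"
    using W1_bound by (intro integrable_const_bound[where B = 1]) auto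
  have int2: "integrable M W2"
    by (intro integrable_const_bound[where B = 1]) (auto simp: W2_def Y2_def indicator_def)
  have "expectation (\<lambda>\<omega>. centred_rank i \<omega> * indicat_real {\<omega> \<in> space M. c * \<epsilon> k \<omega> > x} \<omega>) =
      expectation (\<lambda>\<omega>. W1 \<omega> * W2 \<omega>)"
  proof (rule integral_cong_AE)
    show "AE \<omega> in M. centred_rank i \<omega> * indicat_real {\<omega> \<in> space M. c * \<epsilon> k \<omega> > x} \<omega> = W1 \<omega> * W2 \<omega>"
      using W1 AE_space by eventually_elim (simp add: W2)
  qed measurable
  also have "\<dots> = expectation W1 * expectation W2"
    by (rule indep_var_lebesgue_integral[OF indep int1 int2])
  also have "expectation W1 = expectation (centred_rank i)"
    using W1 by (intro integral_cong_AE) (auto elim: eventually_mono)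
  finally show ?thesis by (simp add: expectation_centred_rank[OF i])
qed

text \<open>On the event, X_i is at least c times the noise, hence at least (c / a) x. The rank is
  then squeezed between \<open>2 * G (c / a * x) - 1\<close> and 1, and both bounds lead to the same
  limit.\<close>

lemma expectation_rank_ancestor:
  assumes i: "i \<in> {1..d}" and k: "k \<in> Ancestors E i" and a: "0 < a"
  shows "((\<lambda>x. expectation (\<lambda>\<omega>. centred_rank i \<omega> *
    indicat_real {\<omega> \<in> space M. a * \<epsilon> k \<omega> > x} \<omega>) / noise_survival x) \<longlongrightarrow> a powr \<alpha>) at_top"
proof -
  define G where "G = cdf (distr M borel (X i))"
  interpret D: real_distribution "distr M borel (X i)" using i by (rule real_distribution_X)
  have d: "1 \<le> d" and k_in: "k \<in> {1..d}" using i k Ancestors_subset[OF i] by auto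
  obtain F where F: "aggregating (Ancestors E i) F" and XF: "AE \<omega> in M. X i \<omega> = F (\<lambda>k. \<epsilon> k \<omega>)"
    using noise_representation[OF i] by metis
  obtain c where c: "0 < c" "\<And>e. c * max 0 (e k) \<le> F e"
    using F k unfolding aggregating_def by blast
  note [measurable] = noise_measurable[OF k_in] centred_rank_measurable[OF i]
  define T where "T x = expectation (\<lambda>\<omega>. centred_rank i \<omega> *
    indicat_real {\<omega> \<in> space M. a * \<epsilon> k \<omega> > x} \<omega>)" for x
  have int: "integrable M (\<lambda>\<omega>. centred_rank i \<omega> * indicat_real {\<omega> \<in> space M. a * \<epsilon> k \<omega> > x} \<omega>)"
    for x
    by (rule integrable_const_bound[where B = 1])
      (use centred_rank_bound[OF i] in \<open>auto simp: indicator_def\<close>)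
  \<comment> \<open>The factor \<open>b\<close> will be 1 in the upper bound and
    \<open>2 * G (c / a * x) - 1\<close> in the lower one.\<close>
  have int_I: "has_bochner_integral M (\<lambda>\<omega>. b * indicat_real {\<omega> \<in> space M. a * \<epsilon> k \<omega> > x} \<omega>)
      (b * noise_survival (inverse a * x))" for x b
    unfolding prob_scaled_noise[OF k_in a, symmetric]
    by (intro has_bochner_integral_mult_right has_bochner_integral_real_indicator)
      (auto simp: emeasure_eq_measure)
  have upper: "T x \<le> 1 * noise_survival (inverse a * x)" for x
    unfolding T_def has_bochner_integral_integral_eq[OF int_I, symmetric]
  proof (rule integral_mono_AE[OF int])
    show "integrable M (\<lambda>\<omega>. 1 * indicat_real {\<omega> \<in> space M. x < a * \<epsilon> k \<omega>} \<omega>)"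
      by (rule integrable.intros[OF int_I])
    show "AE \<omega> in M. centred_rank i \<omega> * indicat_real {\<omega> \<in> space M. a * \<epsilon> k \<omega> > x} \<omega> \<le>
        1 * indicat_real {\<omega> \<in> space M. a * \<epsilon> k \<omega> > x} \<omega>"
      using centred_rank_bound[OF i] by (auto simp: indicator_def abs_le_iff)
  qed
  have lower: "(2 * G (c / a * x) - 1) * noise_survival (inverse a * x) \<le> T x" for x
    unfolding T_def has_bochner_integral_integral_eq[OF int_I, symmetric]
  proof (rule integral_mono_AE[OF _ int])
    show "integrable M (\<lambda>\<omega>. (2 * G (c / a * x) - 1) * indicat_real {\<omega> \<in> space M. x < a * \<epsilon> k \<omega>} \<omega>)"
      by (rule integrable.intros[OF int_I])
    show "AE \<omega> in M. (2 * G (c / a * x) - 1) * indicat_real {\<omega> \<in> space M. a * \<epsilon> k \<omega> > x} \<omega> \<le>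
        centred_rank i \<omega> * indicat_real {\<omega> \<in> space M. a * \<epsilon> k \<omega> > x} \<omega>"
      using XF
    proof eventually_elim
      case (elim \<omega>)
      have "G (c / a * x) \<le> G (X i \<omega>)" if "a * \<epsilon> k \<omega> > x"
        unfolding G_def
      proof (rule D.cdf_nondecreasing)
        have "c / a * x \<le> c / a * (a * \<epsilon> k \<omega>)"
          using that a c(1) by (intro mult_left_mono) auto
        also have "\<dots> \<le> c * max 0 (\<epsilon> k \<omega>)" using a c(1) by simp
        also have "\<dots> \<le> X i \<omega>" using c(2)[of "\<lambda>k. \<epsilon> k \<omega>"] elim by simp
        finally show "c / a * x \<le> X i \<omega>" .
      qed
      then show ?case by (simp add: indicator_def centred_rank_def G_def)
    qed
  qed
  have ratio: "((\<lambda>x. noise_survival (inverse a * x) / noise_survival x) \<longlongrightarrow> a powr \<alpha>) at_top"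
    by (rule noise_survival_ratio[OF d a])
  have "filterlim (\<lambda>x. c / a * x) at_top at_top"
    using a c(1) by (intro filterlim_tendsto_pos_mult_at_top[OF tendsto_const _ filterlim_ident]) auto
  then have "((\<lambda>x. G (c / a * x)) \<longlongrightarrow> 1) at_top"
    unfolding G_def by (rule filterlim_compose[OF D.cdf_lim_at_top_prob])
  then have "((\<lambda>x. (2 * G (c / a * x) - 1) * (noise_survival (inverse a * x) / noise_survival x))
      \<longlongrightarrow> (2 * 1 - 1) * a powr \<alpha>) at_top"
    by (intro tendsto_intros ratio)
  then have low_lim: "((\<lambda>x. (2 * G (c / a * x) - 1) * (noise_survival (inverse a * x) / noise_survival x))
      \<longlongrightarrow> a powr \<alpha>) at_top" by simp
  have "((\<lambda>x. T x / noise_survival x) \<longlongrightarrow> a powr \<alpha>) at_top"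
  proof (rule tendsto_sandwich[OF _ _ low_lim ratio])
    show "\<forall>\<^sub>F x in at_top. (2 * G (c / a * x) - 1) * (noise_survival (inverse a * x) / noise_survival x)
        \<le> T x / noise_survival x"
      using noise_survival_pos[OF d]
      by eventually_elim (use lower in \<open>simp add: divide_right_mono\<close>)
    show "\<forall>\<^sub>F x in at_top. T x / noise_survival x \<le> noise_survival (inverse a * x) / noise_survival x"
      using noise_survival_pos[OF d]
      by eventually_elim (use upper in \<open>simp add: divide_right_mono\<close>)
  qed
  then show ?thesis by (simp add: T_def)
qed

section \<open>The ratio formula and the classification\<close>

text \<open>The weights are the powers a_k^\<alpha>, but the classification needs only their
  positivity. Numerator and denominator are both normalised by \<open>noise_survival\<close>, which
  cancels in the quotient.\<close>

lemma causal_tail_coeff_eq: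
  assumes i: "i \<in> {1..d}" and j: "j \<in> {1..d}"
  obtains w where "\<And>k. k \<in> Ancestors E j \<Longrightarrow> 0 < w k"
    "causal_tail_coeff M X j i =
      (\<Sum>k\<in>Ancestors E j \<inter> Ancestors E i. w k) / (\<Sum>k\<in>Ancestors E j. w k)"
proof -
  obtain F where F: "aggregating (Ancestors E j) F" and XF: "AE \<omega> in M. X j \<omega> = F (\<lambda>k. \<epsilon> k \<omega>)"
    using noise_representation[OF j] by metis
  define K where "K = Ancestors E j"
  define a where "a k = F (unit_noise k)" for k
  have d: "1 \<le> d" using j by auto
  have K: "finite K" "K \<noteq> {}" "K \<subseteq> {1..d}"
    using j finite_Ancestors Ancestors_subset by (auto simp: K_def Ancestors_def)
  have a_pos: "0 < a k" if "k \<in> K" for k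
    using aggregating_unit_pos[OF F] that by (simp add: a_def K_def)
  let ?A = "\<lambda>x. {\<omega> \<in> space M. X j \<omega> > x}"
  let ?B = "\<lambda>k x. {\<omega> \<in> space M. a k * \<epsilon> k \<omega> > x}"
  have jump: "((\<lambda>x. expectation (\<lambda>\<omega>. Z \<omega> * indicat_real (?A x) \<omega>) / noise_survival x)
      \<longlongrightarrow> (\<Sum>k\<in>K. b k)) at_top"
    if Z: "random_variable borel Z" "\<And>\<omega>. \<bar>Z \<omega>\<bar> \<le> 1"
      and b: "\<And>k. k \<in> K \<Longrightarrow> ((\<lambda>x. expectation (\<lambda>\<omega>. Z \<omega> * indicat_real (?B k x) \<omega>) /
        noise_survival x) \<longlongrightarrow> b k) at_top" for Z b
  proof -
    have "((\<lambda>x. \<Sum>k\<in>K. expectation (\<lambda>\<omega>. Z \<omega> * indicat_real (?B k x) \<omega>) / noise_survival x)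
        \<longlongrightarrow> (\<Sum>k\<in>K. b k)) at_top"
      by (intro tendsto_sum b)
    from tendsto_add[OF single_big_jump[OF j F XF Z, folded K_def a_def] this]
    show ?thesis by (simp add: diff_divide_distrib sum_divide_distrib)
  qed
  have num: "((\<lambda>x. expectation (\<lambda>\<omega>. centred_rank i \<omega> * indicat_real (?A x) \<omega>) / noise_survival x)
      \<longlongrightarrow> (\<Sum>k\<in>K. if k \<in> Ancestors E i then a k powr \<alpha> else 0)) at_top"
  proof (rule jump)
    show "random_variable borel (centred_rank i)" using i by (rule centred_rank_measurable)
    show "\<bar>centred_rank i \<omega>\<bar> \<le> 1" for \<omega> using i by (rule centred_rank_bound)
    fix k
    assume k: "k \<in> K"
    show "((\<lambda>x. expectation (\<lambda>\<omega>. centred_rank i \<omega> * indicat_real (?B k x) \<omega>) / noise_survival x)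
        \<longlongrightarrow> (if k \<in> Ancestors E i then a k powr \<alpha> else 0)) at_top"
    proof (cases "k \<in> Ancestors E i")
      case True
      then show ?thesis using expectation_rank_ancestor[OF i True a_pos[OF k]] by simp
    next
      case False
      moreover have "k \<in> {1..d}" using k K by blast
      ultimately show ?thesis using expectation_rank_non_ancestor[OF i] by simp
    qed
  qed
  have den: "((\<lambda>x. expectation (\<lambda>\<omega>. 1 * indicat_real (?A x) \<omega>) / noise_survival x)
      \<longlongrightarrow> (\<Sum>k\<in>K. a k powr \<alpha>)) at_top"
  proof (rule jump)
    fix k
    assume k: "k \<in> K"
    then have "k \<in> {1..d}" using K by blast
    then have "expectation (\<lambda>\<omega>. 1 * indicat_real (?B k x) \<omega>) = noise_survival (inverse (a k) * x)" for x
      using prob_scaled_noise[OF _ a_pos[OF k]] noise_measurable by simp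
    then show "((\<lambda>x. expectation (\<lambda>\<omega>. 1 * indicat_real (?B k x) \<omega>) / noise_survival x)
        \<longlongrightarrow> a k powr \<alpha>) at_top"
      using noise_survival_ratio[OF d a_pos[OF k]] by simp
  qed auto
  have den_pos: "0 < (\<Sum>k\<in>K. a k powr \<alpha>)"
    using K a_pos by (intro sum_pos) (auto simp: order_less_imp_not_eq2)
  have "((\<lambda>x. cond_expectation_event M (\<lambda>\<omega>. 2 * cdf (distr M borel (X i)) (X i \<omega>) - 1) (?A x)) \<longlongrightarrow>
      (\<Sum>k\<in>K. if k \<in> Ancestors E i then a k powr \<alpha> else 0) / (\<Sum>k\<in>K. a k powr \<alpha>)) at_top"
  proof (rule Lim_transform_eventually[OF tendsto_divide[OF num den]])
    show "(\<Sum>k\<in>K. a k powr \<alpha>) \<noteq> 0" using den_pos by simp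
    show "\<forall>\<^sub>F x in at_top. expectation (\<lambda>\<omega>. centred_rank i \<omega> * indicat_real (?A x) \<omega>) / noise_survival x /
        (expectation (\<lambda>\<omega>. 1 * indicat_real (?A x) \<omega>) / noise_survival x) =
        cond_expectation_event M (\<lambda>\<omega>. 2 * cdf (distr M borel (X i)) (X i \<omega>) - 1) (?A x)"
      using noise_survival_pos[OF d]
    proof eventually_elim
      case (elim x)
      have "expectation (\<lambda>\<omega>. 1 * indicat_real (?A x) \<omega>) = prob (?A x)"
        using X_measurable[OF j] by simp
      then show ?case
        using elim
        by (simp add: cond_expectation_event_def set_lebesgue_integral_def centred_rank_def mult.commute)
    qed
  qed
  \<comment> \<open>Convergence has just been established, so \<open>Lim\<close> denotes this
    limit.\<close>
  then have "causal_tail_coeff M X j i =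
      (\<Sum>k\<in>K. if k \<in> Ancestors E i then a k powr \<alpha> else 0) / (\<Sum>k\<in>K. a k powr \<alpha>)"
    unfolding causal_tail_coeff_def by (intro tendsto_Lim) simp
  then have "causal_tail_coeff M X j i =
      (\<Sum>k\<in>K \<inter> Ancestors E i. a k powr \<alpha>) / (\<Sum>k\<in>K. a k powr \<alpha>)"
    using K(1) by (simp add: sum.inter_restrict)
  then show ?thesis
    using that[of "\<lambda>k. a k powr \<alpha>"] a_pos unfolding K_def by force
qed

lemma Ancestors_subset_iff: "Ancestors E j \<subseteq> Ancestors E i \<longleftrightarrow> j \<in> Ancestors E i"
  unfolding Ancestors_def ancestors_def by (auto intro: trancl_trans)

text \<open>The denominator splits into the sums over the common ancestors and over the other
  ancestors of j. With positive weights the ratio is 0 or 1 exactly when the first or the second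
  index set is empty; the latter means that all of \<open>Ancestors E j\<close> lies in
  \<open>Ancestors E i\<close>.\<close>

lemma causal_tail_coeff_classification:
  assumes i: "i \<in> {1..d}" and j: "j \<in> {1..d}"
  shows "0 \<le> causal_tail_coeff M X j i" "causal_tail_coeff M X j i \<le> 1"
    and "causal_tail_coeff M X j i = 0 \<longleftrightarrow> Ancestors E j \<inter> Ancestors E i = {}"
    and "causal_tail_coeff M X j i = 1 \<longleftrightarrow> j \<in> Ancestors E i"
proof -
  let ?K = "Ancestors E j" and ?L = "Ancestors E i"
  obtain w where w: "\<And>k. k \<in> ?K \<Longrightarrow> 0 < w k"
    "causal_tail_coeff M X j i = (\<Sum>k\<in>?K \<inter> ?L. w k) / (\<Sum>k\<in>?K. w k)"
    using causal_tail_coeff_eq[OF i j] by metis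
  have fin: "finite ?K" using j by (rule finite_Ancestors)
  have "?K \<noteq> {}" by (auto simp: Ancestors_def)
  then have pos: "0 < (\<Sum>k\<in>?K. w k)" using fin w(1) by (intro sum_pos)
  have split: "(\<Sum>k\<in>?K. w k) = (\<Sum>k\<in>?K \<inter> ?L. w k) + (\<Sum>k\<in>?K - ?L. w k)"
    using fin by (rule sum.Int_Diff)
  have nonneg: "0 \<le> (\<Sum>k\<in>?K \<inter> ?L. w k)" "0 \<le> (\<Sum>k\<in>?K - ?L. w k)"
    by (auto intro!: sum_nonneg less_imp_le[OF w(1)])
  have zero: "(\<Sum>k\<in>A. w k) = 0 \<longleftrightarrow> A = {}" if "A \<subseteq> ?K" for A
  proof -
    have pos_A: "0 < w k" if "k \<in> A" for k using that \<open>A \<subseteq> ?K\<close> w(1) by blast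
    have "(\<Sum>k\<in>A. w k) = 0 \<longleftrightarrow> (\<forall>k\<in>A. w k = 0)"
      using finite_subset[OF that fin] less_imp_le[OF pos_A] by (rule sum_nonneg_eq_0_iff)
    then show ?thesis using pos_A by (metis all_not_in_conv less_irrefl)
  qed
  show "0 \<le> causal_tail_coeff M X j i" "causal_tail_coeff M X j i \<le> 1"
    using w(2) pos split nonneg by auto
  show "causal_tail_coeff M X j i = 0 \<longleftrightarrow> ?K \<inter> ?L = {}"
    using w(2) pos zero[of "?K \<inter> ?L"] by auto
  have "causal_tail_coeff M X j i = 1 \<longleftrightarrow> ?K - ?L = {}"
    using w(2) pos split zero[of "?K - ?L"] by (auto simp: divide_eq_1_iff)
  then show "causal_tail_coeff M X j i = 1 \<longleftrightarrow> j \<in> Ancestors E i"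
    using Ancestors_subset_iff by simp
qed

end

text \<open>Both coefficients vanish together, as the intersection of ancestor sets is symmetric.
  Acyclicity rules out the pair (1, 1), and a causal link makes the ancestor sets meet, which rules
  out a 1 beside a 0.\<close>

theorem theorem7:
  fixes M :: "'a measure"
    and d :: nat
    and E :: "(nat \<times> nat) set"
    and f :: "nat \<Rightarrow> (nat option \<Rightarrow> real) \<Rightarrow> real"
    and \<epsilon> X :: "nat \<Rightarrow> 'a \<Rightarrow> real"
    and \<alpha> :: real
  assumes "2 \<le> d"
    and "ht_hscm M d E f \<epsilon> \<alpha> X"
  shows
    "(1 \<in> ancestors E 2 \<longleftrightarrow>
        causal_tail_coeff M X 1 2 = 1 \<and> causal_tail_coeff M X 2 1 \<in> {0<..<1}) \<and>
     (2 \<in> ancestors E 1 \<longleftrightarrow>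
        causal_tail_coeff M X 1 2 \<in> {0<..<1} \<and> causal_tail_coeff M X 2 1 = 1) \<and>
     (Ancestors E 1 \<inter> Ancestors E 2 = {} \<longleftrightarrow>
        causal_tail_coeff M X 1 2 = 0 \<and> causal_tail_coeff M X 2 1 = 0) \<and>
     ((\<exists>j. j \<notin> {1, 2} \<and> j \<in> ancestors E 1 \<inter> ancestors E 2) \<and>
        1 \<notin> ancestors E 2 \<and> 2 \<notin> ancestors E 1 \<longleftrightarrow>
        causal_tail_coeff M X 1 2 \<in> {0<..<1} \<and> causal_tail_coeff M X 2 1 \<in> {0<..<1}) \<and>
     ((causal_tail_coeff M X 1 2, causal_tail_coeff M X 2 1)
        \<in> {1} \<times> {0<..<1} \<union> {0<..<1} \<times> {1} \<union> {(0, 0)} \<union> {0<..<1} \<times> {0<..<1})"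
proof -
  interpret ht_hscm M d E f \<epsilon> \<alpha> X by fact
  have V: "1 \<in> {1..d}" "2 \<in> {1..d}" using assms(1) by auto
  let ?\<Gamma> = "causal_tail_coeff M X"
  note coeff = causal_tail_coeff_classification[OF V(2) V(1)]
    causal_tail_coeff_classification[OF V(1) V(2)]
  have in_iff: "1 \<in> Ancestors E 2 \<longleftrightarrow> 1 \<in> ancestors E 2" "2 \<in> Ancestors E 1 \<longleftrightarrow> 2 \<in> ancestors E 1"
    by (auto simp: Ancestors_def)
  have not_both: "\<not> (1 \<in> ancestors E 2 \<and> 2 \<in> ancestors E 1)"
    using acyclic_edges unfolding ancestors_def acyclic_def by (auto dest: trancl_trans)
  have common: "1 \<in> ancestors E 2 \<or> 2 \<in> ancestors E 1 \<Longrightarrow> Ancestors E 1 \<inter> Ancestors E 2 \<noteq> {}"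
    by (auto simp: Ancestors_def)
  \<comment> \<open>Without a link between them, neither 1 nor 2 lies in both ancestor sets, so any
    common element is a proper ancestor of both.\<close>
  have confounder: "(\<exists>j. j \<notin> {1, 2} \<and> j \<in> ancestors E 1 \<inter> ancestors E 2) \<longleftrightarrow>
      Ancestors E 1 \<inter> Ancestors E 2 \<noteq> {}" if "1 \<notin> ancestors E 2" "2 \<notin> ancestors E 1"
    using that unfolding Ancestors_def by auto
  have one: "?\<Gamma> 1 2 = 1 \<longleftrightarrow> 1 \<in> ancestors E 2" "?\<Gamma> 2 1 = 1 \<longleftrightarrow> 2 \<in> ancestors E 1"
    using coeff(4,8) in_iff by auto
  have zero: "?\<Gamma> 1 2 = 0 \<longleftrightarrow> Ancestors E 1 \<inter> Ancestors E 2 = {}"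
      "?\<Gamma> 2 1 = 0 \<longleftrightarrow> Ancestors E 1 \<inter> Ancestors E 2 = {}"
    using coeff(3,7) by (auto simp: Int_commute)
  have open_iff: "?\<Gamma> 1 2 \<in> {0<..<1} \<longleftrightarrow> ?\<Gamma> 1 2 \<noteq> 0 \<and> ?\<Gamma> 1 2 \<noteq> 1"
      "?\<Gamma> 2 1 \<in> {0<..<1} \<longleftrightarrow> ?\<Gamma> 2 1 \<noteq> 0 \<and> ?\<Gamma> 2 1 \<noteq> 1"
    using coeff(1,2,5,6) by auto
  show ?thesis
    unfolding Un_iff mem_Times_iff fst_conv snd_conv singleton_iff prod.inject open_iff one zero
    using not_both common confounder by blast
qed

end
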